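(* Let $\mathbf{Q}$ be the Quad, i.e. (up to affine transformation) the convex quadrilateral with vertices $A=(0,0)$, $B=(2,0)$, $C=(3,1)$, $D=(0,4)$, and let $T$ be the symplectic billiard map of $\mathbf{Q}$ on the phase space $\Phi_{\mathbf{Q}}$. Then all orbits of $T$ are periodic, with periods $20$ and $36$. The structure of the orbits of the periodic tiles is as follows: (i) one orbit of tiles consisting of tiles that return to themselves after $10$ iterations of $T$, with the return map having order $2$; (ii) one orbit of tiles consisting of tiles that return to themselves after $9$ iterations of $T$, with the return map having order $4$.
   Context: Symplectic billiard. Let $\mathbf{P}$ be a convex polygon with vertices $P_1,\dots,P_n$ in counterclockwise order, and $v_i=P_{i+1}-P_i$ (indices cyclic). Write $[\cdot,\cdot]$ for the determinant of two plane vectors and $v_i\times v_j$ for the set of oriented chords $(x,y)$ with tail $x$ in the interior of side $P_iP_{i+1}$ and head $y$ in the interior of side $P_jP_{j+1}$. The symplectic billiard map is $T(x,y)=(y,z)$, where $z\neq x$ is the second intersection point with the boundary of $\mathbf{P}$ of the line through $x$ parallel to the side containing $y$. Iteration is undefined once the head is a vertex of $\mathbf{P}$. The (reduced) phase space $\Phi_{\mathbf{P}}$ is the union of the sets $v_i\times v_j$ with $[v_i,v_j]>0$; $T$ preserves the condition $[v_i,v_j]>0$. Area form: on $v_i\times v_j$, with arc-length coordinates $x,y$ on the two sides, the area form is $\sin\alpha\,dx\wedge dy$, where $\alpha$ is the angle between $v_i$ and $v_j$ (so the total area of $v_i\times v_j$ is $[v_i,v_j]$). "All orbits" refers to phase points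 all of whose forward and backward iterates under $T$ are defined. A point $p$ has period $k$ if $T^k(p)=p$ (not necessarily the minimal period). "Periods $20$ and $36$" means every orbit has one of these as a period, and both occur. The symbolic orbit of a phase point is the bi-infinite sequence of labels of the sides visited by its orbit. A tile is the set of all phase points with a given symbolic orbit; the periodic tiles considered here are those of positive area. $T$ maps tiles to tiles, so one can speak of the orbit of a tile; "returns to itself after $k$ iterations" means $k\ge 1$ is least with $T^k(M)=M$, and the return map of $M$ is $T^k|_M$; its order is the least $r\ge1$ with $(T^k|_M)^r=\mathrm{id}$. Symplectic billiards commute with affine transformations of the plane, so the statement depends only on the affine class of $\mathbf{Q}$. *)

theory Defs
  imports "HOL-Analysis.Analysis"
begin

type_synonym point = "real \<times> real"

(* An oriented chord: (tail, head). *)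
type_synonym chord = "point \<times> point"

definition cross :: "point \<Rightarrow> point \<Rightarrow> real" where
  "cross u v = fst u * snd v - snd u * fst v"

(* A polygon is the list of its vertices; indices are cyclic and start at 0. *)

definition vertex :: "point list \<Rightarrow> nat \<Rightarrow> point" where
  "vertex P i = P ! (i mod length P)"

definition edge :: "point list \<Rightarrow> nat \<Rightarrow> point" where
  "edge P i = vertex P (Suc i) - vertex P i"

definition side :: "point list \<Rightarrow> nat \<Rightarrow> point set" where
  "side P i = open_segment (vertex P i) (vertex P (Suc i))"

(* Every vertex not on a side lies strictly to the left of that side, so the vertices are
   distinct, in convex position and listed counterclockwise. *)
definition ccw_convex_polygon :: "point list \<Rightarrow> bool" where
  "ccw_convex_polygon P \<longleftrightarrow> 3 \<le> length P \<and>
     (\<forall>i < length P. \<forall>k < length P. k \<noteq> i \<and> k \<noteq> Suc i mod length P \<longrightarrow>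
        0 < cross (edge P i) (vertex P k - vertex P i))"

definition affinely_equivalent :: "point set \<Rightarrow> point set \<Rightarrow> bool" where
  "affinely_equivalent S S' \<longleftrightarrow> (\<exists>h c. linear h \<and> bij h \<and> S' = (\<lambda>x. c + h x) ` S)"

definition side_pairs :: "point list \<Rightarrow> (nat \<times> nat) set" where
  "side_pairs P = {(i, j). i < length P \<and> j < length P \<and> 0 < cross (edge P i) (edge P j)}"

definition phase_space :: "point list \<Rightarrow> chord set" where
  "phase_space P = (\<Union>(i, j) \<in> side_pairs P. side P i \<times> side P j)"

(* Meaningful on the phase space, where the point z exists and is unique.  If z is a vertex,
   the value lies outside the phase space and the orbit ends there. *)
definition symp_map :: "point list \<Rightarrow> chord \<Rightarrow> chord" where
  "symp_map P = (\<lambda>(x, y). (y, THE z. z \<noteq> x \<and> z \<in> frontier (convex hull (set P)) \<and>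
     (\<exists>j < length P. y \<in> side P j \<and> (\<exists>t. z = x + t *\<^sub>R edge P j))))"

definition full_orbit :: "point list \<Rightarrow> (int \<Rightarrow> chord) \<Rightarrow> bool" where
  "full_orbit P f \<longleftrightarrow> (\<forall>m. f m \<in> phase_space P \<and> f (m + 1) = symp_map P (f m))"

(* Phase points all of whose forward and backward iterates are defined. *)
definition regular_points :: "point list \<Rightarrow> chord set" where
  "regular_points P = {p. \<exists>f. full_orbit P f \<and> f 0 = p}"

definition has_period :: "point list \<Rightarrow> nat \<Rightarrow> chord \<Rightarrow> bool" where
  "has_period P k p \<longleftrightarrow> (symp_map P ^^ k) p = p"

(* The phase points with symbolic orbit s; empty if s is not the symbolic orbit of any point.
   The map is injective on the phase space, so f is determined by p = f 0.  The head of f m is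
   the tail of f (m + 1), so the tails record all sides visited. *)
definition tile :: "point list \<Rightarrow> (int \<Rightarrow> nat) \<Rightarrow> chord set" where
  "tile P s = {p. \<exists>f. full_orbit P f \<and> f 0 = p \<and>
     (\<forall>m. s m < length P \<and> fst (f m) \<in> side P (s m))}"

(* The area form on each product of sides is sin(alpha) dx dy in arc-length coordinates,
   where sin(alpha) = [v_i, v_j] / (|v_i| |v_j|). *)
definition area :: "point list \<Rightarrow> chord set \<Rightarrow> real" where
  "area P M = (\<Sum>(i, j) \<in> side_pairs P.
     cross (edge P i) (edge P j) / (norm (edge P i) * norm (edge P j)) *
     measure lborel {(a, b). 0 < a \<and> a < norm (edge P i) \<and> 0 < b \<and> b < norm (edge P j) \<and>
       (vertex P i + a *\<^sub>R sgn (edge P i), vertex P j + b *\<^sub>R sgn (edge P j)) \<in> M})"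

definition periodic_tiles :: "point list \<Rightarrow> chord set set" where
  "periodic_tiles P = {M. (\<exists>s. M = tile P s) \<and> 0 < area P M \<and>
     (\<exists>k \<ge> 1. (symp_map P ^^ k) ` M = M)}"

(* For a periodic tile the forward images already exhaust the two-sided orbit. *)
definition tile_orbit :: "point list \<Rightarrow> chord set \<Rightarrow> chord set set" where
  "tile_orbit P M = {(symp_map P ^^ m) ` M | m. True}"

definition returns_after :: "point list \<Rightarrow> chord set \<Rightarrow> nat \<Rightarrow> bool" where
  "returns_after P M k \<longleftrightarrow> 1 \<le> k \<and> (symp_map P ^^ k) ` M = M \<and>
     (\<forall>j. 1 \<le> j \<and> j < k \<longrightarrow> (symp_map P ^^ j) ` M \<noteq> M)"

definition has_order_on :: "('a \<Rightarrow> 'a) \<Rightarrow> 'a set \<Rightarrow> nat \<Rightarrow> bool" where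
  "has_order_on g M r \<longleftrightarrow> 1 \<le> r \<and> (\<forall>p \<in> M. (g ^^ r) p = p) \<and>
     (\<forall>j. 1 \<le> j \<and> j < r \<longrightarrow> \<not> (\<forall>p \<in> M. (g ^^ j) p = p))"

end

theory Submission
  imports Defs
begin

text \<open>
  Measure the two ends of a chord as fractions of the sides they lie on.  Every branch of the
  symplectic billiard map of the Quad then has the form \<open>(a, b) \<mapsto> (b, g a)\<close> with \<open>g\<close> affine and
  decreasing.  The first return map to the chords from the third to the fourth side has only three
  branches; following them shows that every orbit that never meets a vertex runs through one of two
  cycles of 10 and 9 open rectangles.  Since each \<open>g\<close> reverses the direction of its side, in
  coordinates centred at the rectangles the map is the rotation \<open>(u, v) \<mapsto> (v, - u)\<close> by a right
  angle.  Hence the return map of a rectangle is the rotation by 10 or 9 right angles, of order 2 or 4.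
  A polygon whose affine equivalence with the Quad reverses the orientation has the same orbits run
  backwards.
\<close>

section \<open>Chords of a convex polygon\<close>

definition side_point :: "point list \<Rightarrow> nat \<Rightarrow> real \<Rightarrow> point" where
  "side_point P i t = vertex P i + t *\<^sub>R edge P i"

lemma cross_simps:
  "cross (u + v) w = cross u w + cross v w"
  "cross w (u + v) = cross w u + cross w v"
  "cross (u - v) w = cross u w - cross v w"
  "cross w (u - v) = cross w u - cross w v"
  "cross (a *\<^sub>R u) w = a * cross u w"
  "cross w (a *\<^sub>R u) = a * cross w u"
  "cross (- u) w = - cross u w"
  "cross w (- u) = - cross w u"
  "cross u u = 0" "cross 0 w = 0" "cross w 0 = 0"
  by (simp_all add: cross_def algebra_simps)

lemma cross_commute: "cross u v = - cross v u"
  by (simp add: cross_def)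

lemma cross_zero_imp_scaleR:
  assumes "cross e w = 0" "e \<noteq> 0"
  shows "\<exists>t. w = t *\<^sub>R e"
proof (cases "fst e = 0")
  case True
  with assms have "snd e \<noteq> 0" "fst w = 0"
    by (auto simp: cross_def prod_eq_iff)
  with True have "w = (snd w / snd e) *\<^sub>R e"
    by (simp add: prod_eq_iff)
  then show ?thesis ..
next
  case False
  with assms have "w = (fst w / fst e) *\<^sub>R e"
    by (simp add: prod_eq_iff cross_def field_simps)
  then show ?thesis ..
qed

lemma cross_eq_inner: "cross e x = (- snd e, fst e) \<bullet> x"
  by (simp add: cross_def inner_prod_def)

lemma left_halfplane_eq:
  "{x. 0 \<le> cross e (x - v)} = {x. (- snd e, fst e) \<bullet> x \<ge> cross e v}"
  by (simp add: cross_simps flip: cross_eq_inner)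

lemma convex_left_halfplane: "convex {x. 0 \<le> cross e (x - v)}"
  unfolding left_halfplane_eq by (rule convex_halfspace_ge)

lemma interior_left_halfplane:
  assumes "e \<noteq> 0"
  shows "interior {x. 0 \<le> cross e (x - v)} = {x. 0 < cross e (x - v)}"
proof -
  have "(- snd e, fst e) \<noteq> 0"
    using assms by (auto simp: prod_eq_iff)
  then have "interior {x. 0 \<le> cross e (x - v)} = {x. (- snd e, fst e) \<bullet> x > cross e v}"
    unfolding left_halfplane_eq by (rule interior_halfspace_ge)
  then show ?thesis
    by (simp add: cross_simps flip: cross_eq_inner)
qed

lemma vertex_mod [simp]: "vertex P (i mod length P) = vertex P i"
  by (simp add: vertex_def)

lemma vertex_Suc_mod [simp]: "vertex P (Suc (i mod length P)) = vertex P (Suc i)"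
  by (simp add: vertex_def mod_Suc_eq)

lemma edge_mod [simp]: "edge P (i mod length P) = edge P i"
  by (simp add: edge_def)

lemma side_mod [simp]: "side P (i mod length P) = side P i"
  by (simp add: side_def)

lemma side_point_mod [simp]: "side_point P (i mod length P) = side_point P i"
  by (simp add: side_point_def fun_eq_iff)

lemma side_point_affine: "side_point P i t = (1 - t) *\<^sub>R vertex P i + t *\<^sub>R vertex P (Suc i)"
  by (simp add: side_point_def edge_def algebra_simps)

lemma side_eq_side_point: "edge P i \<noteq> 0 \<Longrightarrow> side P i = side_point P i ` {0<..<1}"
  by (force simp: side_def edge_def side_point_affine in_segment)

locale convex_polygon =
  fixes P :: "point list"
  assumes ccw: "ccw_convex_polygon P"
begin

lemma length_ge: "3 \<le> length P"
  using ccw by (simp add: ccw_convex_polygon_def)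

lemma left_of_edge:
  assumes "k mod length P \<noteq> i mod length P" "k mod length P \<noteq> Suc i mod length P"
  shows "0 < cross (edge P i) (vertex P k - vertex P i)"
proof -
  have "0 < length P"
    using length_ge by linarith
  then have "0 < cross (edge P (i mod length P)) (vertex P (k mod length P) - vertex P (i mod length P))"
    using ccw assms unfolding ccw_convex_polygon_def by (metis mod_less_divisor mod_Suc_eq)
  then show ?thesis
    by simp
qed

lemma left_of_edge_weak: "0 \<le> cross (edge P i) (vertex P k - vertex P i)"
proof -
  consider "k mod length P = i mod length P" | "k mod length P = Suc i mod length P"
    | "k mod length P \<noteq> i mod length P" "k mod length P \<noteq> Suc i mod length P"
    by blast
  then show ?thesis
  proof cases
    case 1
    then have "vertex P k = vertex P i"
      by (metis vertex_mod)
    then show ?thesis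
      by (simp add: cross_simps)
  next
    case 2
    then have "vertex P k = vertex P (Suc i)"
      by (metis vertex_mod)
    then show ?thesis
      by (simp add: edge_def cross_simps)
  next
    case 3
    then show ?thesis
      by (meson left_of_edge less_imp_le)
  qed
qed

lemma Suc_mod_neq: "Suc i mod length P \<noteq> i mod length P"
  using length_ge by (simp add: mod_Suc)

lemma Suc_Suc_mod_neq: "Suc (Suc i) mod length P \<noteq> i mod length P"
  using length_ge by (simp add: mod_Suc)

lemma left_of_edge_Suc_Suc: "0 < cross (edge P i) (vertex P (Suc (Suc i)) - vertex P i)"
  using Suc_Suc_mod_neq Suc_mod_neq by (intro left_of_edge) auto

lemma edge_nonzero: "edge P i \<noteq> 0"
  using left_of_edge_Suc_Suc[of i] by (auto simp: cross_simps)

lemma side_eq: "side P i = side_point P i ` {0<..<1}"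
  by (simp add: edge_nonzero side_eq_side_point)

lemma side_point_inject [simp]: "side_point P i s = side_point P i t \<longleftrightarrow> s = t"
  using edge_nonzero by (simp add: side_point_def)

lemma left_of_other_edge:
  assumes "j mod length P \<noteq> i mod length P" "x \<in> side P j"
  shows "0 < cross (edge P i) (x - vertex P i)"
proof -
  obtain u where u: "0 < u" "u < 1" "x = (1 - u) *\<^sub>R vertex P j + u *\<^sub>R vertex P (Suc j)"
    using assms(2) by (auto simp: side_def in_segment)
  let ?g = "\<lambda>k. cross (edge P i) (vertex P k - vertex P i)"
  have "cross (edge P i) (x - vertex P i) = (1 - u) * ?g j + u * ?g (Suc j)"
    unfolding u(3) by (simp add: cross_simps algebra_simps)
  moreover have "0 \<le> ?g j" "0 \<le> ?g (Suc j)"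
    by (rule left_of_edge_weak)+
  moreover have "0 < ?g j \<or> 0 < ?g (Suc j)"
  proof (cases "j mod length P = Suc i mod length P")
    case True
    then have "Suc j mod length P = Suc (Suc i) mod length P"
      by (metis mod_Suc_eq)
    then show ?thesis
      by (metis left_of_edge_Suc_Suc vertex_mod)
  next
    case False
    then show ?thesis
      using assms(1) left_of_edge by blast
  qed
  ultimately show ?thesis
    using u by (smt (verit) mult_nonneg_nonneg mult_pos_pos)
qed

lemma side_unique:
  assumes "x \<in> side P i" "x \<in> side P j"
  shows "i mod length P = j mod length P"
proof (rule ccontr)
  assume "i mod length P \<noteq> j mod length P"
  then have "0 < cross (edge P j) (x - vertex P j)"
    using assms(1) left_of_other_edge by blast
  then show False
    using assms(2) by (auto simp: side_eq side_point_def cross_simps)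
qed

abbreviation region :: "point set" where
  "region \<equiv> convex hull (set P)"

lemma vertex_in_set: "vertex P i \<in> set P"
  using length_ge unfolding vertex_def
  by (metis mod_less_divisor not_numeral_le_zero not_gr_zero nth_mem)

lemma vertex_in_region: "vertex P i \<in> region"
  by (simp add: hull_inc vertex_in_set)

lemma closed_region: "closed region"
  by (simp add: compact_convex_hull finite_imp_compact compact_imp_closed)

lemma region_left_of_edge: "region \<subseteq> {x. 0 \<le> cross (edge P i) (x - vertex P i)}"
proof (rule hull_minimal)
  show "set P \<subseteq> {x. 0 \<le> cross (edge P i) (x - vertex P i)}"
  proof
    fix x assume "x \<in> set P"
    then obtain k where "k < length P" "x = P ! k"
      by (metis in_set_conv_nth)
    then have "x = vertex P k"
      by (simp add: vertex_def)
    then show "x \<in> {x. 0 \<le> cross (edge P i) (x - vertex P i)}"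
      using left_of_edge_weak by simp
  qed
qed (rule convex_left_halfplane)

lemma side_in_frontier:
  assumes "x \<in> side P i"
  shows "x \<in> frontier region"
proof -
  have "side P i \<subseteq> region"
    using vertex_in_region convex_convex_hull unfolding side_def
    by (metis closed_segment_subset open_closed_segment subsetI subsetD)
  then have "x \<in> region"
    using assms by blast
  moreover have "x \<notin> interior region"
  proof
    assume "x \<in> interior region"
    then have "0 < cross (edge P i) (x - vertex P i)"
      using interior_mono[OF region_left_of_edge] interior_left_halfplane[OF edge_nonzero] by blast
    then show False
      using assms by (auto simp: side_eq side_point_def cross_simps)
  qed
  ultimately show ?thesis
    by (simp add: frontier_def closed_region)
qed

lemma interior_region_nonempty: "interior region \<noteq> {}"
proof
  assume "interior region = {}"
  then obtain a b where ab: "a \<noteq> 0" "region \<subseteq> {x. a \<bullet> x = b}"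
    using empty_interior_subset_hyperplane[of region] by (metis convex_convex_hull)
  have v: "a \<bullet> vertex P i = b" for i
    using ab(2) vertex_in_region by blast
  let ?u = "edge P 0" and ?w = "vertex P 2 - vertex P 0"
  have perp: "a \<bullet> ?u = 0" "a \<bullet> ?w = 0"
    using v by (simp_all add: edge_def inner_diff_right)
  have "fst a * cross ?u ?w = snd ?w * (a \<bullet> ?u) - snd ?u * (a \<bullet> ?w)"
    "snd a * cross ?u ?w = fst ?u * (a \<bullet> ?w) - fst ?w * (a \<bullet> ?u)"
    by (simp_all add: cross_def inner_prod_def algebra_simps)
  moreover have "cross ?u ?w \<noteq> 0"
    using left_of_edge_Suc_Suc[of 0] by (simp add: numeral_2_eq_2)
  ultimately show False
    using ab(1) perp by (auto simp: prod_eq_iff)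
qed

text \<open>The end points of the side through \<open>x\<close> lie strictly on different sides of the line.\<close>
lemma line_meets_interior:
  assumes x: "x \<in> side P i" and tr: "cross (edge P i) e \<noteq> 0"
  shows "\<exists>s. s \<noteq> 0 \<and> x + s *\<^sub>R e \<in> interior region"
proof -
  obtain m where m: "m \<in> interior region"
    using interior_region_nonempty by blast
  obtain u where u: "0 < u" "u < 1" "x = side_point P i u"
    using x by (auto simp: side_eq)
  define g where "g p = cross e (p - x)" for p
  have g0: "g (vertex P i) = - u * cross e (edge P i)"
    unfolding g_def u(3) side_point_def by (simp add: cross_simps algebra_simps)
  have g1: "g (vertex P (Suc i)) = (1 - u) * cross e (edge P i)"
  proof -
    have "vertex P (Suc i) = vertex P i + edge P i"
      by (simp add: edge_def)
    then show ?thesis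
      unfolding g_def u(3) side_point_def by (simp add: cross_simps algebra_simps)
  qed
  have ne: "e \<noteq> 0" "cross e (edge P i) \<noteq> 0"
    using tr cross_commute[of e] by (auto simp: cross_simps)
  have "\<exists>p \<in> region. g m * g p < 0 \<or> g m = 0"
  proof -
    have "g (vertex P i) * g (vertex P (Suc i)) < 0"
    proof -
      have "0 < (u * (1 - u)) * (cross e (edge P i) * cross e (edge P i))"
        using u ne by (simp add: zero_less_mult_iff neq_iff disj_commute)
      then show ?thesis
        unfolding g0 g1 by (simp add: algebra_simps)
    qed
    then have "g m * g (vertex P i) < 0 \<or> g m * g (vertex P (Suc i)) < 0 \<or> g m = 0"
      by (auto simp: mult_less_0_iff linorder_neq_iff)
    then show ?thesis
      using vertex_in_region by blast
  qed
  then obtain p where p: "p \<in> region" "g m * g p < 0 \<or> g m = 0"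
    by blast
  have "\<exists>q \<in> interior region. g q = 0"
  proof (cases "g m = 0")
    case False
    define l where "l = g m / (g m - g p)"
    have "0 < l" "l < 1" "(1 - l) * g m + l * g p = 0"
      using p(2) False unfolding l_def by (auto simp: mult_less_0_iff field_simps)
    moreover have "g ((1 - l) *\<^sub>R m + l *\<^sub>R p) = (1 - l) * g m + l * g p"
      unfolding g_def by (simp add: cross_simps algebra_simps)
    moreover have "m \<noteq> p"
      using p(2) False by (auto simp: mult_less_0_iff)
    ultimately show ?thesis
      using in_interior_closure_convex_segment[OF convex_convex_hull m, of p] p(1) closed_region
      by (force simp: in_segment)
  qed (use m in blast)
  then obtain q s where q: "q \<in> interior region" "q - x = s *\<^sub>R e"
    using cross_zero_imp_scaleR ne(1) unfolding g_def by blast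
  moreover from this have "q = x + s *\<^sub>R e"
    by (simp add: algebra_simps)
  moreover have "x \<notin> interior region"
    using side_in_frontier[OF x] by (simp add: frontier_def)
  ultimately show ?thesis
    by (metis add.right_neutral scaleR_zero_left)
qed

lemma second_point_ex1:
  assumes x: "x \<in> side P i" and tr: "cross (edge P i) e \<noteq> 0"
  shows "\<exists>!z. z \<noteq> x \<and> z \<in> frontier region \<and> (\<exists>t. z = x + t *\<^sub>R e)"
proof -
  obtain s where s: "s \<noteq> 0" "x + s *\<^sub>R e \<in> interior region"
    using line_meets_interior assms by blast
  have "e \<noteq> 0"
    using tr by (auto simp: cross_simps)
  define F where "F = {t. x + t *\<^sub>R e \<in> frontier region}"
  have "bounded region"
    by (simp add: bounded_convex_hull finite_imp_bounded)
  then obtain d where d: "0 < d" "(x + s *\<^sub>R e) + d *\<^sub>R (s *\<^sub>R e) \<in> frontier region"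
    using ray_to_frontier[of region "x + s *\<^sub>R e" "s *\<^sub>R e"] s \<open>e \<noteq> 0\<close> by auto
  define t where "t = s * (1 + d)"
  have t: "t \<in> F"
    using d by (simp add: F_def t_def algebra_simps)
  have "t \<noteq> 0"
    using d(1) s(1) by (simp add: t_def)
  have "0 \<in> F"
    using side_in_frontier[OF x] by (simp add: F_def)
  have "s \<notin> F"
    using s by (simp add: F_def frontier_def)
  have between: "\<not> (s < t \<and> t < r \<or> r < t \<and> t < s)" if "r \<in> F" "t \<in> F" for r t
  proof
    assume st: "s < t \<and> t < r \<or> r < t \<and> t < s"
    define l where "l = (t - s) / (r - s)"
    have l: "0 < l" "l < 1" "t = (1 - l) * s + l * r"
      using st unfolding l_def by (auto simp: field_simps)
    have "x + t *\<^sub>R e = (1 - l) *\<^sub>R (x + s *\<^sub>R e) + l *\<^sub>R (x + r *\<^sub>R e)"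
      unfolding l(3) by (simp add: algebra_simps)
    moreover have "x + s *\<^sub>R e \<noteq> x + r *\<^sub>R e"
      using st \<open>e \<noteq> 0\<close> by auto
    ultimately have "x + t *\<^sub>R e \<in> open_segment (x + s *\<^sub>R e) (x + r *\<^sub>R e)"
      using l by (auto simp: in_segment)
    moreover have "x + r *\<^sub>R e \<in> closure region"
      using that(1) by (simp add: F_def frontier_def)
    ultimately have "x + t *\<^sub>R e \<in> interior region"
      using in_interior_closure_convex_segment[OF convex_convex_hull s(2)] by blast
    then show False
      using that(2) by (simp add: F_def frontier_def)
  qed
  have unique: "r = t" if "r \<noteq> 0" "r \<in> F" for r
  proof -
    have "s < 0 \<and> t < s \<or> 0 < s \<and> s < t"
      using s(1) d(1) unfolding t_def by (auto simp: linorder_neq_iff mult_less_0_iff algebra_simps)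
    moreover have "r \<noteq> s"
      using that(2) \<open>s \<notin> F\<close> by blast
    ultimately show ?thesis
      using between[OF that(2) t] between[OF t that(2)]
        between[OF that(2) \<open>0 \<in> F\<close>] between[OF \<open>0 \<in> F\<close> that(2)] that(1)
      by linarith
  qed
  show ?thesis
  proof (rule ex1I)
    show "x + t *\<^sub>R e \<noteq> x \<and> x + t *\<^sub>R e \<in> frontier region \<and> (\<exists>r. x + t *\<^sub>R e = x + r *\<^sub>R e)"
      using t \<open>t \<noteq> 0\<close> \<open>e \<noteq> 0\<close> by (auto simp: F_def)
  next
    fix z assume "z \<noteq> x \<and> z \<in> frontier region \<and> (\<exists>r. z = x + r *\<^sub>R e)"
    then show "z = x + t *\<^sub>R e"
      using unique by (auto simp: F_def)
  qed
qed

lemma symp_map_iff: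
  assumes x: "x \<in> side P i" and y: "y \<in> side P j" and z: "z \<in> side P k"
    and tr: "cross (edge P i) (edge P j) \<noteq> 0"
  shows "symp_map P (x, y) = (y, z) \<longleftrightarrow> z \<noteq> x \<and> cross (edge P j) (z - x) = 0"
proof -
  let ?A = "\<lambda>z. z \<noteq> x \<and> z \<in> frontier region \<and> (\<exists>t. z = x + t *\<^sub>R edge P j)"
  have "(\<exists>j < length P. y \<in> side P j \<and> (\<exists>t. z = x + t *\<^sub>R edge P j)) \<longleftrightarrow> (\<exists>t. z = x + t *\<^sub>R edge P j)"
    for z
  proof
    assume "\<exists>j < length P. y \<in> side P j \<and> (\<exists>t. z = x + t *\<^sub>R edge P j)"
    then show "\<exists>t. z = x + t *\<^sub>R edge P j"
      using side_unique y by (metis edge_mod)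
  next
    assume "\<exists>t. z = x + t *\<^sub>R edge P j"
    then show "\<exists>j < length P. y \<in> side P j \<and> (\<exists>t. z = x + t *\<^sub>R edge P j)"
      using length_ge y by (intro exI[of _ "j mod length P"]) (auto intro: mod_less_divisor)
  qed
  then have "symp_map P (x, y) = (y, THE z. ?A z)"
    by (simp add: symp_map_def)
  moreover have "(THE z. ?A z) = z \<longleftrightarrow> ?A z"
  proof -
    have ex1: "\<exists>!z. ?A z"
      using second_point_ex1[OF x tr] .
    show ?thesis
      using theI'[OF ex1] the1_equality[OF ex1, of z] by blast
  qed
  moreover have "?A z \<longleftrightarrow> z \<noteq> x \<and> cross (edge P j) (z - x) = 0"
  proof -
    have "(\<exists>t. z = x + t *\<^sub>R edge P j) \<longleftrightarrow> cross (edge P j) (z - x) = 0"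
    proof
      assume "cross (edge P j) (z - x) = 0"
      then obtain t where "z - x = t *\<^sub>R edge P j"
        using cross_zero_imp_scaleR edge_nonzero by blast
      then have "z = x + t *\<^sub>R edge P j"
        by (simp add: algebra_simps)
      then show "\<exists>t. z = x + t *\<^sub>R edge P j" ..
    qed (auto simp: cross_simps)
    then show ?thesis
      using side_in_frontier[OF z] by blast
  qed
  ultimately show ?thesis
    by simp
qed

end

section \<open>Cyclically rotating tiles\<close>

context convex_polygon
begin

lemma area_rectangle_pos:
  assumes ij: "(i, j) \<in> side_pairs P"
    and bounds: "0 \<le> l" "l < r" "r \<le> 1" "0 \<le> l'" "l' < r'" "r' \<le> 1"
  shows "0 < area P (side_point P i ` {l<..<r} \<times> side_point P j ` {l'<..<r'})"
proof -
  define M where "M = side_point P i ` {l<..<r} \<times> side_point P j ` {l'<..<r'}"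
  define g where "g = (\<lambda>(i, j). cross (edge P i) (edge P j) / (norm (edge P i) * norm (edge P j)) *
     measure lborel {(a, b). 0 < a \<and> a < norm (edge P i) \<and> 0 < b \<and> b < norm (edge P j) \<and>
       (vertex P i + a *\<^sub>R sgn (edge P i), vertex P j + b *\<^sub>R sgn (edge P j)) \<in> M})"
  define A where "A = norm (edge P i)"
  define B where "B = norm (edge P j)"
  have AB: "0 < A" "0 < B"
    by (simp_all add: A_def B_def edge_nonzero)
  have arc: "vertex P k + a *\<^sub>R sgn (edge P k) = side_point P k (a / norm (edge P k))" for k a
    by (simp add: side_point_def sgn_div_norm divide_inverse)
  have "{(a, b). 0 < a \<and> a < A \<and> 0 < b \<and> b < B \<and>
      (vertex P i + a *\<^sub>R sgn (edge P i), vertex P j + b *\<^sub>R sgn (edge P j)) \<in> M}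
    = {l * A<..<r * A} \<times> {l' * B<..<r' * B}" (is "?S = _")
  proof -
    have interval: "{a. 0 < a \<and> a < A \<and> l < a / A \<and> a / A < r} = {l * A<..<r * A}"
      if "0 < A" "0 \<le> l" "r \<le> 1" for A l r :: real
    proof -
      have "0 \<le> l * A" "r * A \<le> A"
        using that by simp_all
      then have "(0 < a \<and> a < A \<and> l < a / A \<and> a / A < r) \<longleftrightarrow> l * A < a \<and> a < r * A" for a
        using pos_less_divide_eq[OF that(1), of l a] pos_divide_less_eq[OF that(1), of a r] by linarith
      then show ?thesis
        by (simp add: greaterThanLessThan_def greaterThan_def lessThan_def Collect_conj_eq[symmetric])
    qed
    have "?S = {a. 0 < a \<and> a < A \<and> l < a / A \<and> a / A < r} \<times>
        {b. 0 < b \<and> b < B \<and> l' < b / B \<and> b / B < r'}"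
      unfolding M_def arc by (auto simp: A_def B_def image_iff)
    then show ?thesis
      using interval AB bounds by simp
  qed
  also have "\<dots> = box (l * A, l' * B) (r * A, r' * B)"
    by (simp add: box_prod)
  finally have S: "?S = box (l * A, l' * B) (r * A, r' * B)" .
  have "0 < measure lborel (box (l * A, l' * B) (r * A, r' * B))"
    using AB bounds
    by (auto simp: measure_lborel_box_eq Basis_prod_def intro!: prod_pos)
  moreover have "0 < cross (edge P i) (edge P j)"
    using ij by (simp add: side_pairs_def)
  ultimately have "0 < g (i, j)"
    using AB unfolding g_def A_def[symmetric] B_def[symmetric] prod.case S by simp
  moreover have "0 \<le> g q" if "q \<in> side_pairs P" for q
    using that unfolding g_def side_pairs_def by (auto intro!: mult_nonneg_nonneg divide_nonneg_nonneg)
  moreover have "finite (side_pairs P)"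
    by (rule finite_subset[of _ "{..<length P} \<times> {..<length P}"]) (auto simp: side_pairs_def)
  ultimately have "0 < sum g (side_pairs P)"
    using ij by (meson sum_pos2)
  then show ?thesis
    by (simp add: area_def g_def M_def)
qed

lemma area_empty [simp]: "area P {} = 0"
  by (simp add: area_def)

lemma funpow_full_orbit:
  assumes "full_orbit P f"
  shows "(symp_map P ^^ k) (f m) = f (m + int k)"
proof (induction k)
  case (Suc k)
  have "symp_map P (f (m + int k)) = f (m + int k + 1)"
    using assms by (simp add: full_orbit_def)
  with Suc show ?case
    by (simp add: ac_simps)
qed simp

lemma full_orbit_shift: "full_orbit P f \<Longrightarrow> full_orbit P (\<lambda>m. f (k + m))"
  unfolding full_orbit_def by (metis add.assoc)

end

text \<open>Continues \<open>w\<close> to a sequence of period 4; one step is a rotation by a right angle.\<close>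
definition turn :: "real \<times> real \<Rightarrow> int \<Rightarrow> real" where
  "turn w m = [fst w, snd w, - fst w, - snd w] ! nat (m mod 4)"

lemma mod_4_cases: "(m :: int) mod 4 = 0 \<or> m mod 4 = 1 \<or> m mod 4 = 2 \<or> m mod 4 = 3"
  by presburger

lemma turn_add_2 [simp]: "turn w (m + 2) = - turn w m"
  using mod_4_cases[of m] by (elim disjE; simp add: turn_def mod_add_left_eq[symmetric, of m])

lemma turn_0 [simp]: "turn w 0 = fst w" and turn_1 [simp]: "turn w 1 = snd w"
  by (simp_all add: turn_def)

lemma turn_period: "4 dvd k \<Longrightarrow> turn w (m + k) = turn w m"
  by (auto simp: turn_def elim!: dvdE)

lemma turn_shift: "turn (turn w k, turn w (k + 1)) m = turn w (k + m)"
  using mod_4_cases[of m] mod_4_cases[of k]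
  by (elim disjE; simp add: turn_def mod_add_left_eq[symmetric, of k] mod_add_right_eq[symmetric, of _ m])

definition unit_square :: "(real \<times> real) set" where
  "unit_square = {-1<..<1} \<times> {-1<..<1}"

lemma turn_bounds: "w \<in> unit_square \<Longrightarrow> - 1 < turn w m" "w \<in> unit_square \<Longrightarrow> turn w m < 1"
  using mod_4_cases[of m] by (force simp: turn_def unit_square_def)+

lemma turn_in_unit_square: "w \<in> unit_square \<Longrightarrow> (turn w k, turn w (k + 1)) \<in> unit_square"
  using turn_bounds[of w] by (auto simp: unit_square_def)

text \<open>For \<open>c \<in> {9, 10}\<close>, \<open>lab c n\<close> is the label of the \<open>n\<close>-th side visited by a cycle of \<open>c\<close> tiles,
  and \<open>mid c n\<close>, \<open>rad c n\<close> are the centre and half length of the part of that side which the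
  cycle occupies, as fractions of the side.  The assumption \<open>parallel\<close> says that \<open>symp_map\<close> acts
  on the cycle by the rotation \<open>(u, v) \<mapsto> (v, - u)\<close> in centred coordinates.\<close>
locale rotating_tiles = convex_polygon P for P +
  fixes lab :: "nat \<Rightarrow> int \<Rightarrow> nat" and mid rad :: "nat \<Rightarrow> int \<Rightarrow> real"
  assumes period: "c \<in> {9, 10} \<Longrightarrow> lab c (n + int c) = lab c n"
      "c \<in> {9, 10} \<Longrightarrow> mid c (n + int c) = mid c n"
      "c \<in> {9, 10} \<Longrightarrow> rad c (n + int c) = rad c n"
    and rad_pos: "c \<in> {9, 10} \<Longrightarrow> 0 < rad c n"
    and rad_le: "c \<in> {9, 10} \<Longrightarrow> rad c n \<le> mid c n"
    and rad_le': "c \<in> {9, 10} \<Longrightarrow> mid c n + rad c n \<le> 1"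
    and lab_pairs: "c \<in> {9, 10} \<Longrightarrow> (lab c n, lab c (n + 1)) \<in> side_pairs P"
    and lab_neq: "c \<in> {9, 10} \<Longrightarrow> lab c (n + 2) \<noteq> lab c n"
    and parallel: "c \<in> {9, 10} \<Longrightarrow> cross (edge P (lab c (n + 1)))
        (side_point P (lab c (n + 2)) (mid c (n + 2) - rad c (n + 2) * u) -
         side_point P (lab c n) (mid c n + rad c n * u)) = 0"
    and lab_determines: "c \<in> {9, 10} \<Longrightarrow> c' \<in> {9, 10} \<Longrightarrow> (\<And>m. lab c (n + m) = lab c' (n' + m)) \<Longrightarrow>
        c = c' \<and> int c dvd n' - n"
    and exhaust: "full_orbit P f \<Longrightarrow> \<exists>m \<le> 0. \<exists>c \<in> {9, 10}. \<exists>n. \<exists>(u, v) \<in> unit_square.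
        f m = (side_point P (lab c n) (mid c n + rad c n * u),
               side_point P (lab c (n + 1)) (mid c (n + 1) + rad c (n + 1) * v))"
begin

definition pos :: "nat \<Rightarrow> int \<Rightarrow> real \<Rightarrow> point" where
  "pos c n u = side_point P (lab c n) (mid c n + rad c n * u)"

definition orb :: "nat \<Rightarrow> int \<Rightarrow> real \<times> real \<Rightarrow> int \<Rightarrow> chord" where
  "orb c n w m = (pos c (n + m) (turn w m), pos c (n + m + 1) (turn w (m + 1)))"

definition rect :: "nat \<Rightarrow> int \<Rightarrow> chord set" where
  "rect c n = (\<lambda>w. orb c n w 0) ` unit_square"

lemma lab_less: "c \<in> {9, 10} \<Longrightarrow> lab c n < length P"
  using lab_pairs by (auto simp: side_pairs_def)

lemma pos_add: "c \<in> {9, 10} \<Longrightarrow> pos c (n + int c) = pos c n"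
  by (simp add: pos_def period fun_eq_iff)

lemma pos_period:
  assumes c: "c \<in> {9, 10}" and k: "int c dvd k"
  shows "pos c (n + k) = pos c n"
proof -
  have nat: "pos c (n + int c * int j) = pos c n" for n j
  proof (induction j)
    case (Suc j)
    then show ?case
      using pos_add[OF c, of "n + int c * int j"] by (simp add: algebra_simps)
  qed simp
  obtain j where j: "k = int c * j"
    using k by blast
  show ?thesis
  proof (cases "0 \<le> j")
    case True
    then show ?thesis
      using nat[of n "nat j"] j by simp
  next
    case False
    then show ?thesis
      using nat[of "n + k" "nat (- j)"] j by simp
  qed
qed

lemma pos_in_side:
  assumes "c \<in> {9, 10}" "- 1 < u" "u < 1"
  shows "pos c n u \<in> side P (lab c n)"
proof -
  have "\<bar>rad c n * u\<bar> < rad c n * 1"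
    using assms(2,3) rad_pos[OF assms(1), of n] by (simp add: abs_mult)
  then have "mid c n + rad c n * u \<in> {0<..<1}"
    using rad_le[OF assms(1), of n] rad_le'[OF assms(1), of n] by auto
  then show ?thesis
    unfolding pos_def side_eq by blast
qed

lemma pos_inject: "c \<in> {9, 10} \<Longrightarrow> pos c n u = pos c n v \<longleftrightarrow> u = v"
  using rad_pos[of c n] by (auto simp: pos_def)

lemma pos_side_iff:
  assumes "c \<in> {9, 10}" "- 1 < u" "u < 1" "k < length P"
  shows "pos c n u \<in> side P k \<longleftrightarrow> k = lab c n"
  using pos_in_side[OF assms(1-3)] side_unique lab_less[OF assms(1)] assms(4) by (metis mod_less)

lemma orb_shift: "orb c n w (k + m) = orb c (n + k) (turn w k, turn w (k + 1)) m"
  by (simp add: orb_def turn_shift add.assoc)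

lemma orb_period:
  assumes "c \<in> {9, 10}" "int c dvd k" "4 dvd k"
  shows "orb c n w (m + k) = orb c n w m"
  using pos_period[OF assms(1,2), of "n + m"] pos_period[OF assms(1,2), of "n + m + 1"]
    turn_period[OF assms(3), of w m] turn_period[OF assms(3), of w "m + 1"]
  by (simp add: orb_def ac_simps)

lemma full_orbit_orb:
  assumes c: "c \<in> {9, 10}" and w: "w \<in> unit_square"
  shows "full_orbit P (orb c n w)"
  unfolding full_orbit_def
proof
  fix m
  let ?x = "\<lambda>k. pos c (n + m + k) (turn w (m + k))"
  have side: "?x k \<in> side P (lab c (n + m + k))" for k
    using pos_in_side[OF c] turn_bounds[OF w] by blast
  have pairs: "(lab c (n + m), lab c (n + m + 1)) \<in> side_pairs P"
    using lab_pairs[OF c] .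
  have orb: "orb c n w m = (?x 0, ?x 1)" "orb c n w (m + 1) = (?x 1, ?x 2)"
    by (simp_all add: orb_def ac_simps)
  have "orb c n w m \<in> phase_space P"
    using pairs side[of 0] side[of 1] unfolding orb phase_space_def by (auto intro!: bexI[OF _ pairs])
  moreover have "symp_map P (?x 0, ?x 1) = (?x 1, ?x 2)"
  proof -
    have "cross (edge P (lab c (n + m + 1))) (?x 2 - ?x 0) = 0"
      using parallel[OF c, of "n + m" "turn w m"] by (simp add: pos_def)
    moreover have "?x 2 \<noteq> ?x 0"
    proof
      assume "?x 2 = ?x 0"
      then have "lab c (n + m + 2) = lab c (n + m)"
        using side[of 2] side[of 0] side_unique lab_less[OF c] by (metis add.right_neutral mod_less)
      then show False
        using lab_neq[OF c] by blast
    qed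
    ultimately show ?thesis
      using symp_map_iff[OF side[of 0] side[of 1] side[of 2]] pairs by (auto simp: side_pairs_def)
  qed
  ultimately show "orb c n w m \<in> phase_space P \<and> orb c n w (m + 1) = symp_map P (orb c n w m)"
    unfolding orb by simp
qed

lemma funpow_orb:
  "c \<in> {9, 10} \<Longrightarrow> w \<in> unit_square \<Longrightarrow> (symp_map P ^^ k) (orb c n w m) = orb c n w (m + int k)"
  by (simp add: full_orbit_orb funpow_full_orbit)

lemma orb_in_rect:
  assumes "w \<in> unit_square"
  shows "orb c n w m \<in> rect c (n + m)"
  using orb_shift[of c n w m 0] turn_in_unit_square[OF assms, of m] by (auto simp: rect_def)

lemma full_orbit_start:
  assumes "full_orbit P f"
  obtains c n w where "c \<in> {9, 10}" "w \<in> unit_square" "f 0 = orb c n w 0"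
proof -
  obtain m c n u v where *: "m \<le> 0" "c \<in> {9, 10}" "(u, v) \<in> unit_square" "f m = orb c n (u, v) 0"
    using exhaust[OF assms] by (simp add: orb_def pos_def del: insert_iff) blast
  have "f 0 = (symp_map P ^^ nat (- m)) (f m)"
    using funpow_full_orbit[OF assms] *(1) by simp
  also have "\<dots> = orb c n (u, v) (- m)"
    using funpow_orb[OF *(2,3)] * by simp
  finally have "f 0 \<in> rect c (n + - m)"
    using orb_in_rect[OF *(3), of c n "- m"] by simp
  then show ?thesis
    using that *(2) by (auto simp: rect_def)
qed

lemma full_orbit_period:
  assumes f: "full_orbit P f" and k: "180 dvd k"
  shows "f (m + k) = f m"
proof -
  have step: "f (m + 180) = f m" for m
  proof -
    obtain c n w where *: "c \<in> {9, 10}" "w \<in> unit_square" "f m = orb c n w 0"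
      using full_orbit_start[OF full_orbit_shift[OF f, of m]] by (metis add.right_neutral)
    have "f (m + 180) = (symp_map P ^^ 180) (f m)"
      using funpow_full_orbit[OF f, of 180 m] by simp
    also have "\<dots> = orb c n w (0 + 180)"
      using funpow_orb[OF *(1,2), of 180 n 0] *(3) by simp
    also have "\<dots> = f m"
      unfolding *(3) using *(1) by (intro orb_period) auto
    finally show ?thesis .
  qed
  have nat: "f (m + 180 * int j) = f m" for m j
  proof (induction j)
    case (Suc j)
    then show ?case
      using step[of "m + 180 * int j"] by (simp add: algebra_simps)
  qed simp
  obtain j where j: "k = 180 * j"
    using k by blast
  show ?thesis
  proof (cases "0 \<le> j")
    case True
    then show ?thesis
      using nat[of m "nat j"] j by simp
  next
    case False
    then show ?thesis
      using nat[of "m + k" "nat (- j)"] j by simp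
  qed
qed

text \<open>Periodicity reduces backward iterates to forward ones.\<close>
lemma full_orbit_unique:
  assumes f: "full_orbit P f" and g: "full_orbit P g" and "f 0 = g 0"
  shows "f = g"
proof
  fix m
  define k :: int where "k = 180 * \<bar>m\<bar>"
  have "0 \<le> m + k" "180 dvd k"
    by (auto simp: k_def)
  then show "f m = g m"
    using full_orbit_period[OF f, of k m] full_orbit_period[OF g, of k m]
      funpow_full_orbit[OF f, of "nat (m + k)" 0] funpow_full_orbit[OF g, of "nat (m + k)" 0] assms(3)
    by simp
qed

lemma full_orbit_iff:
  "full_orbit P f \<longleftrightarrow> (\<exists>c n w. c \<in> {9, 10} \<and> w \<in> unit_square \<and> f = orb c n w)"
  using full_orbit_start full_orbit_unique full_orbit_orb by metis

lemma regular_points_eq: "regular_points P = (\<Union>c \<in> {9, 10}. \<Union>n. rect c n)"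
  unfolding regular_points_def full_orbit_iff rect_def by blast

lemma orb_side_iff:
  assumes "c \<in> {9, 10}" "w \<in> unit_square" "k < length P"
  shows "fst (orb c n w m) \<in> side P k \<longleftrightarrow> k = lab c (n + m)"
  using pos_side_iff[OF assms(1) turn_bounds[OF assms(2)] assms(3)] by (simp add: orb_def)

lemma tile_eq_orb: "tile P s = {orb c n w 0 |c n w. c \<in> {9, 10} \<and> w \<in> unit_square \<and> s = (\<lambda>m. lab c (n + m))}"
proof -
  have "(\<forall>m. s m < length P \<and> fst (orb c n w m) \<in> side P (s m)) \<longleftrightarrow> s = (\<lambda>m. lab c (n + m))"
    if "c \<in> {9, 10}" "w \<in> unit_square" for c n w
    using orb_side_iff[OF that] lab_less[OF that(1)] by (metis (no_types, lifting) ext)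
  then show ?thesis
    unfolding tile_def full_orbit_iff by blast
qed

lemma rect_period:
  assumes "c \<in> {9, 10}" "int c dvd k"
  shows "rect c (n + k) = rect c n"
  using pos_period[OF assms, of n] pos_period[OF assms, of "n + 1"]
  by (simp add: rect_def orb_def ac_simps)

lemma tile_eq_rect:
  assumes c: "c \<in> {9, 10}"
  shows "tile P (\<lambda>m. lab c (n + m)) = rect c n"
proof
  show "rect c n \<subseteq> tile P (\<lambda>m. lab c (n + m))"
    using c unfolding tile_eq_orb rect_def by blast
next
  show "tile P (\<lambda>m. lab c (n + m)) \<subseteq> rect c n"
  proof
    fix p assume "p \<in> tile P (\<lambda>m. lab c (n + m))"
    then obtain c' n' w where *: "c' \<in> {9, 10}" "w \<in> unit_square" "p = orb c' n' w 0"
      "(\<lambda>m. lab c (n + m)) = (\<lambda>m. lab c' (n' + m))"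
      unfolding tile_eq_orb by blast
    then have "c = c'" "int c dvd n' - n"
      using lab_determines[OF c *(1)] by (metis+)
    then have "rect c' n' = rect c n"
      using rect_period[OF c, of "n' - n" n] by simp
    then show "p \<in> rect c n"
      using * by (auto simp: rect_def)
  qed
qed

lemma rect_eq_iff:
  assumes c: "c \<in> {9, 10}" and c': "c' \<in> {9, 10}"
  shows "rect c n = rect c' n' \<longleftrightarrow> c = c' \<and> int c dvd n' - n"
proof
  assume eq: "rect c n = rect c' n'"
  have "(0, 0) \<in> unit_square"
    by (simp add: unit_square_def)
  then obtain w where w: "w \<in> unit_square" "orb c n (0, 0) 0 = orb c' n' w 0"
    using eq unfolding rect_def by blast
  then have "orb c n (0, 0) = orb c' n' w"
    using full_orbit_unique full_orbit_orb c c' \<open>(0, 0) \<in> unit_square\<close> by blast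
  then have "lab c (n + m) = lab c' (n' + m)" for m
    using orb_side_iff[OF c \<open>(0, 0) \<in> unit_square\<close>] orb_side_iff[OF c' w(1)] lab_less c by metis
  then show "c = c' \<and> int c dvd n' - n"
    using lab_determines c c' by blast
next
  assume "c = c' \<and> int c dvd n' - n"
  then show "rect c n = rect c' n'"
    using rect_period[OF c, of "n' - n" n] by auto
qed

lemma rect_eq_Times:
  assumes "c \<in> {9, 10}"
  shows "rect c n = side_point P (lab c n) ` {mid c n - rad c n<..<mid c n + rad c n} \<times>
    side_point P (lab c (n + 1)) ` {mid c (n + 1) - rad c (n + 1)<..<mid c (n + 1) + rad c (n + 1)}"
proof -
  have "(\<lambda>u. m + r * u) ` {-1<..<1} = {m - r<..<m + r}" if "0 < r" for m r :: real
  proof -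
    have "x \<in> (\<lambda>u. m + r * u) ` {-1<..<1}" if "x \<in> {m - r<..<m + r}" for x
      using that \<open>0 < r\<close> by (intro image_eqI[of _ _ "(x - m) / r"]) (auto simp: field_simps)
    moreover have "m + r * u \<in> {m - r<..<m + r}" if "u \<in> {-1<..<1}" for u
      using that \<open>0 < r\<close> mult_strict_left_mono[of u 1 r] mult_strict_left_mono[of "- 1" u r] by simp
    ultimately show ?thesis
      by blast
  qed
  then have "pos c k ` {-1<..<1} = side_point P (lab c k) ` {mid c k - rad c k<..<mid c k + rad c k}" for k
    using rad_pos[OF assms] unfolding pos_def by (metis image_image)
  moreover have "rect c n = pos c n ` {-1<..<1} \<times> pos c (n + 1) ` {-1<..<1}"
    by (force simp: rect_def orb_def unit_square_def)
  ultimately show ?thesis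
    by simp
qed

lemma area_rect: "c \<in> {9, 10} \<Longrightarrow> 0 < area P (rect c n)"
  unfolding rect_eq_Times
  using rad_pos[of c n] rad_le[of c n] rad_le'[of c n]
    rad_pos[of c "n + 1"] rad_le[of c "n + 1"] rad_le'[of c "n + 1"]
  by (intro area_rectangle_pos lab_pairs) auto

lemma funpow_rect:
  assumes "c \<in> {9, 10}"
  shows "(symp_map P ^^ k) ` rect c n = rect c (n + int k)"
proof
  show "(symp_map P ^^ k) ` rect c n \<subseteq> rect c (n + int k)"
    using funpow_orb[OF assms] orb_in_rect by (force simp: rect_def)
next
  show "rect c (n + int k) \<subseteq> (symp_map P ^^ k) ` rect c n"
  proof
    fix p assume "p \<in> rect c (n + int k)"
    then obtain w where w: "w \<in> unit_square" "p = orb c (n + int k) w 0"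
      by (auto simp: rect_def)
    then have "p = (symp_map P ^^ k) (orb c (n + int k) w (- int k))"
      using funpow_orb[OF assms w(1)] by simp
    moreover have "orb c (n + int k) w (- int k) \<in> rect c n"
      using orb_in_rect[OF w(1), of c "n + int k" "- int k"] by simp
    ultimately show "p \<in> (symp_map P ^^ k) ` rect c n"
      by blast
  qed
qed

lemma returns_after_rect: "c \<in> {9, 10} \<Longrightarrow> returns_after P (rect c n) c"
  unfolding returns_after_def
  by (auto simp: funpow_rect rect_period rect_eq_iff dest: zdvd_imp_le)

lemma has_period_rect:
  assumes "c \<in> {9, 10}" "p \<in> rect c n" "c dvd k" "4 dvd k"
  shows "has_period P k p"
proof -
  have "int c dvd int k" "4 dvd int k"
    using assms(3,4) by presburger+
  then show ?thesis
    using assms funpow_orb[OF assms(1), of _ k n 0] orb_period[OF assms(1), of "int k" n _ 0]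
    by (auto simp: has_period_def rect_def)
qed

lemma has_order_on_rect:
  assumes c: "c \<in> {9, 10}" and r: "1 \<le> r" "4 dvd c * r" "\<And>j. 1 \<le> j \<Longrightarrow> j < r \<Longrightarrow> \<not> 4 dvd c * j"
  shows "has_order_on (symp_map P ^^ c) (rect c n) r"
proof -
  have "((symp_map P ^^ c) ^^ r) p = p" if "p \<in> rect c n" for p
    using has_period_rect[OF c that, of "c * r"] r(2) by (simp add: has_period_def funpow_mult mult.commute)
  moreover have "\<exists>p \<in> rect c n. ((symp_map P ^^ c) ^^ j) p \<noteq> p" if j: "1 \<le> j" "j < r" for j
  proof (rule bexI)
    let ?w = "(1 / 2, 1 / 3) :: real \<times> real"
    have w: "?w \<in> unit_square"
      by (simp add: unit_square_def)
    then show "orb c n ?w 0 \<in> rect c n"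
      by (auto simp: rect_def)
    show "((symp_map P ^^ c) ^^ j) (orb c n ?w 0) \<noteq> orb c n ?w 0"
    proof
      assume "((symp_map P ^^ c) ^^ j) (orb c n ?w 0) = orb c n ?w 0"
      then have "orb c n ?w (int (c * j)) = orb c n ?w 0"
        using funpow_orb[OF c w, of "c * j" n 0] by (simp add: funpow_mult mult.commute)
      then have "turn ?w (int (c * j)) = 1 / 2"
        using pos_inject[OF c] pos_period[OF c, of "int (c * j)" n] by (simp add: orb_def)
      then have "int (c * j) mod 4 = 0"
        using mod_4_cases[of "int (c * j)"] by (auto simp: turn_def)
      then show False
        using r(3)[OF j] by presburger
    qed
  qed
  ultimately show ?thesis
    using r(1) by (auto simp: has_order_on_def)
qed

lemma periodic_tiles_eq: "periodic_tiles P = {rect c n |c n. c \<in> {9, 10}}"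
proof
  show "periodic_tiles P \<subseteq> {rect c n |c n. c \<in> {9, 10}}"
  proof
    fix M assume "M \<in> periodic_tiles P"
    then obtain s where "M = tile P s" "M \<noteq> {}"
      by (force simp: periodic_tiles_def)
    then show "M \<in> {rect c n |c n. c \<in> {9, 10}}"
      using tile_eq_rect by (force simp: tile_eq_orb)
  qed
next
  show "{rect c n |c n. c \<in> {9, 10}} \<subseteq> periodic_tiles P"
  proof
    fix M assume "M \<in> {rect c n |c n. c \<in> {9, 10}}"
    then obtain c n where c: "c \<in> {9, 10}" and M: "M = rect c n"
      by blast
    have "M = tile P (\<lambda>m. lab c (n + m))" "0 < area P M"
      unfolding M using tile_eq_rect[OF c] area_rect[OF c] by simp_all
    moreover have "1 \<le> c" "(symp_map P ^^ c) ` M = M"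
      unfolding M using returns_after_rect[OF c, of n] by (simp_all add: returns_after_def)
    ultimately show "M \<in> periodic_tiles P"
      unfolding periodic_tiles_def by blast
  qed
qed

lemma tile_orbit_rect:
  assumes "c \<in> {9, 10}"
  shows "tile_orbit P (rect c n) = range (rect c)"
proof -
  have "rect c m \<in> tile_orbit P (rect c n)" for m
  proof -
    define k where "k = nat ((m - n) mod int c)"
    have k: "int k = (m - n) mod int c"
      using assms by (auto simp: k_def)
    have "int c dvd n + int k - m"
      unfolding k by (simp add: mod_eq_dvd_iff[symmetric] mod_add_right_eq)
    then have "rect c m = (symp_map P ^^ k) ` rect c n"
      using rect_eq_iff[OF assms assms] funpow_rect[OF assms] by simp
    then show ?thesis
      by (auto simp: tile_orbit_def)
  qed
  then show ?thesis
    using funpow_rect[OF assms] by (auto simp: tile_orbit_def)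
qed

theorem periods_and_tiles:
  "(\<forall>p \<in> regular_points P. has_period P 20 p \<or> has_period P 36 p) \<and>
    (\<exists>p \<in> regular_points P. has_period P 20 p) \<and>
    (\<exists>p \<in> regular_points P. has_period P 36 p) \<and>
    (\<exists>O1 O2. tile_orbit P ` periodic_tiles P = {O1, O2} \<and> O1 \<noteq> O2 \<and>
      (\<forall>M \<in> O1. M \<in> periodic_tiles P \<and> returns_after P M 10 \<and>
         has_order_on (symp_map P ^^ 10) M 2) \<and>
      (\<forall>M \<in> O2. M \<in> periodic_tiles P \<and> returns_after P M 9 \<and>
         has_order_on (symp_map P ^^ 9) M 4))"
proof (intro conjI)
  have 20: "has_period P 20 p" if "p \<in> rect 10 n" for p n
    using that by (intro has_period_rect[of 10]) auto
  have 36: "has_period P 36 p" if "p \<in> rect 9 n" for p n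
    using that by (intro has_period_rect[of 9]) auto
  show "\<forall>p \<in> regular_points P. has_period P 20 p \<or> has_period P 36 p"
    using 20 36 by (auto simp: regular_points_eq)
  have "rect c n \<noteq> {}" for c n
    by (simp add: rect_def unit_square_def)
  then obtain p q where "p \<in> rect 10 0" "q \<in> rect 9 0"
    by (meson ex_in_conv)
  then show "\<exists>p \<in> regular_points P. has_period P 20 p" "\<exists>p \<in> regular_points P. has_period P 36 p"
    using 20 36 unfolding regular_points_eq by blast+
  have "has_order_on (symp_map P ^^ 10) (rect 10 n) 2" for n
    by (rule has_order_on_rect) auto
  moreover have "has_order_on (symp_map P ^^ 9) (rect 9 n) 4" for n
  proof (rule has_order_on_rect)
    fix j :: nat assume "1 \<le> j" "j < 4"
    then have "j \<in> {1, 2, 3}"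
      by auto
    then show "\<not> 4 dvd 9 * j"
      by auto
  qed auto
  moreover have "tile_orbit P ` periodic_tiles P = {range (rect 10), range (rect 9)}"
  proof -
    have "periodic_tiles P = range (rect 10) \<union> range (rect 9)"
      unfolding periodic_tiles_eq by blast
    then show ?thesis
      by (auto simp: image_Un image_image tile_orbit_rect)
  qed
  moreover have "range (rect 10) \<noteq> range (rect 9)"
  proof
    assume "range (rect 10) = range (rect 9)"
    then obtain n where "rect 10 0 = rect 9 n"
      by blast
    then show False
      by (simp add: rect_eq_iff)
  qed
  ultimately show "\<exists>O1 O2. tile_orbit P ` periodic_tiles P = {O1, O2} \<and> O1 \<noteq> O2 \<and>
      (\<forall>M \<in> O1. M \<in> periodic_tiles P \<and> returns_after P M 10 \<and>
         has_order_on (symp_map P ^^ 10) M 2) \<and>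
      (\<forall>M \<in> O2. M \<in> periodic_tiles P \<and> returns_after P M 9 \<and>
         has_order_on (symp_map P ^^ 9) M 4)"
    using returns_after_rect unfolding periodic_tiles_eq
    by (intro exI[of _ "range (rect 10)"] exI[of _ "range (rect 9)"]) auto
qed

end

section \<open>The two cycles of tiles of the Quad\<close>

text \<open>The coefficients come from \<open>C = (3 / 2) B + (1 / 4) D\<close> for \<open>A = (0, 0)\<close>, \<open>B = (2, 0)\<close>, \<open>C = (3, 1)\<close>,
  \<open>D = (0, 4)\<close>.\<close>
definition quad :: "point \<Rightarrow> point \<Rightarrow> point \<Rightarrow> point list" where
  "quad A p q = [A, A + p, A + (3 / 2) *\<^sub>R p + (1 / 4) *\<^sub>R q, A + q]"

lemma edge_quad:
  "edge (quad A p q) 0 = p"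
  "edge (quad A p q) (Suc 0) = (1 / 2) *\<^sub>R p + (1 / 4) *\<^sub>R q"
  "edge (quad A p q) 2 = - (3 / 2) *\<^sub>R p + (3 / 4) *\<^sub>R q"
  "edge (quad A p q) 3 = - q"
  by (simp_all add: edge_def vertex_def quad_def prod_eq_iff)

lemma side_point_quad:
  "side_point (quad A p q) 0 t = A + t *\<^sub>R p"
  "side_point (quad A p q) (Suc 0) t = A + (1 + t / 2) *\<^sub>R p + (t / 4) *\<^sub>R q"
  "side_point (quad A p q) 2 t = A + (3 / 2 - 3 / 2 * t) *\<^sub>R p + (1 / 4 + 3 / 4 * t) *\<^sub>R q"
  "side_point (quad A p q) 3 t = A + (1 - t) *\<^sub>R q"
  unfolding side_point_def edge_quad
  by (simp_all add: vertex_def quad_def prod_eq_iff algebra_simps)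

lemma cross_edge_quad:
  "cross (edge (quad A p q) 0) (edge (quad A p q) (Suc 0)) = cross p q * (1 / 4)"
  "cross (edge (quad A p q) 0) (edge (quad A p q) 2) = cross p q * (3 / 4)"
  "cross (edge (quad A p q) 0) (edge (quad A p q) 3) = cross p q * (- 1)"
  "cross (edge (quad A p q) (Suc 0)) (edge (quad A p q) 0) = cross p q * (- 1 / 4)"
  "cross (edge (quad A p q) (Suc 0)) (edge (quad A p q) 2) = cross p q * (3 / 4)"
  "cross (edge (quad A p q) (Suc 0)) (edge (quad A p q) 3) = cross p q * (- 1 / 2)"
  "cross (edge (quad A p q) 2) (edge (quad A p q) 0) = cross p q * (- 3 / 4)"
  "cross (edge (quad A p q) 2) (edge (quad A p q) (Suc 0)) = cross p q * (- 3 / 4)"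
  "cross (edge (quad A p q) 2) (edge (quad A p q) 3) = cross p q * (3 / 2)"
  "cross (edge (quad A p q) 3) (edge (quad A p q) 0) = cross p q * 1"
  "cross (edge (quad A p q) 3) (edge (quad A p q) (Suc 0)) = cross p q * (1 / 2)"
  "cross (edge (quad A p q) 3) (edge (quad A p q) 2) = cross p q * (- 3 / 2)"
  by (simp_all add: edge_quad cross_def algebra_simps)

lemma cross_chord_quad:
  "cross (edge (quad A p q) (Suc 0)) (side_point (quad A p q) 2 c - side_point (quad A p q) 0 a)
    = cross p q * (3 * c + a - 1) / 4"
  "cross (edge (quad A p q) 2) (side_point (quad A p q) 3 c - side_point (quad A p q) 0 a)
    = cross p q * (2 * c + a - 2) * 3 / 4"
  "cross (edge (quad A p q) 2) (side_point (quad A p q) 3 c - side_point (quad A p q) (Suc 0) a)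
    = cross p q * (2 * c + a - 1) * 3 / 4"
  "cross (edge (quad A p q) 3) (side_point (quad A p q) 0 c - side_point (quad A p q) 2 a)
    = cross p q * (2 * c + 3 * a - 3) / 2"
  "cross (edge (quad A p q) 3) (side_point (quad A p q) (Suc 0) c - side_point (quad A p q) 2 a)
    = cross p q * (c + 3 * a - 1) / 2"
  "cross (edge (quad A p q) 0) (side_point (quad A p q) (Suc 0) c - side_point (quad A p q) 3 a)
    = cross p q * (c + 4 * a - 4) / 4"
  "cross (edge (quad A p q) 0) (side_point (quad A p q) 2 c - side_point (quad A p q) 3 a)
    = cross p q * (3 * c + 4 * a - 3) / 4"
  "cross (edge (quad A p q) (Suc 0)) (side_point (quad A p q) 2 c - side_point (quad A p q) 3 a)
    = cross p q * (3 * c + 2 * a - 3) / 4"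
  unfolding edge_quad side_point_quad cross_def by (simp_all add: field_simps)

definition quad_pairs :: "(nat \<times> nat) set" where
  "quad_pairs = {(0, 1), (0, 2), (1, 2), (2, 3), (3, 0), (3, 1)}"

lemma less_4_cases: "(i :: nat) < 4 \<longleftrightarrow> i = 0 \<or> i = 1 \<or> i = 2 \<or> i = 3"
  by auto

lemma cross_edge_quad_pos_iff:
  assumes "i < 4" "j < 4" "0 < e * cross p q"
  shows "0 < e * cross (edge (quad A p q) i) (edge (quad A p q) j) \<longleftrightarrow> (i, j) \<in> quad_pairs"
proof -
  have "0 < e * (cross p q * k) \<longleftrightarrow> 0 < k" for k
    using assms(3) by (simp add: mult.assoc[symmetric] zero_less_mult_iff[of "e * cross p q"])
  then show ?thesis
    using assms(1,2) unfolding less_4_cases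
    by (elim disjE; simp only: cross_edge_quad One_nat_def; simp add: quad_pairs_def cross_simps)
qed

text \<open>Label, centre and half length of the parts of the sides visited by the two cycles of tiles.\<close>
definition cycle :: "nat \<Rightarrow> (nat \<times> real \<times> real) list" where
  "cycle c = (if c = 9 then
     [(2, 1/6, 1/6), (3, 3/4, 1/4), (1, 1/2, 1/2), (2, 1/2, 1/6), (3, 1/4, 1/4), (0, 3/4, 1/4),
      (2, 2/3, 1/3), (3, 5/8, 1/8), (0, 1/2, 1/2)]
   else
     [(2, 2/3, 1/3), (3, 7/8, 1/8), (0, 1/2, 1/2), (1, 1/2, 1/2), (2, 1/6, 1/6), (3, 1/4, 1/4),
      (1, 1/2, 1/2), (2, 5/6, 1/6), (3, 1/4, 1/4), (0, 1/4, 1/4)])"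

definition cyc :: "nat \<Rightarrow> int \<Rightarrow> nat \<times> real \<times> real" where
  "cyc c n = cycle c ! nat (n mod int c)"

definition qlab :: "nat \<Rightarrow> int \<Rightarrow> nat" where "qlab c n = fst (cyc c n)"
definition qmid :: "nat \<Rightarrow> int \<Rightarrow> real" where "qmid c n = fst (snd (cyc c n))"
definition qrad :: "nat \<Rightarrow> int \<Rightarrow> real" where "qrad c n = snd (snd (cyc c n))"

lemmas q_defs = qlab_def qmid_def qrad_def

lemma cyc_period: "cyc c (n + int c) = cyc c n" "cyc c (n - int c) = cyc c n"
  by (simp_all add: cyc_def)

definition triples :: "nat \<Rightarrow> ((nat \<times> real \<times> real) \<times> (nat \<times> real \<times> real) \<times> (nat \<times> real \<times> real)) set" where
  "triples c = set (zip (cycle c) (zip (rotate1 (cycle c)) (rotate1 (rotate1 (cycle c)))))"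

lemma cyc_triples:
  assumes "c \<in> {9, 10}"
  shows "(cyc c n, cyc c (n + 1), cyc c (n + 2)) \<in> triples c"
proof -
  define k where "k = n mod int c"
  have "cyc c (n + m) = cycle c ! nat ((k + m) mod int c)" for m
    by (simp add: cyc_def k_def mod_add_left_eq)
  note * = this[of 0, simplified] this[of 1] this[of 2]
  have "c = 9 \<and> k \<in> {0, 1, 2, 3, 4, 5, 6, 7, 8} \<or> c = 10 \<and> k \<in> {0, 1, 2, 3, 4, 5, 6, 7, 8, 9}"
  proof -
    have "0 \<le> k" "k < int c"
      using assms by (auto simp: k_def)
    moreover have "c = 9 \<or> c = 10"
      using assms by simp
    ultimately show ?thesis
      unfolding insert_iff empty_iff by presburger
  qed
  then show ?thesis
    unfolding * triples_def insert_iff empty_iff by (elim disjE conjE; simp add: cycle_def)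
qed

lemma cyc_cases:
  assumes "c \<in> {9, 10}" "\<forall>(x, y, z) \<in> triples 9 \<union> triples 10. Q x y z"
  shows "Q (cyc c n) (cyc c (n + 1)) (cyc c (n + 2))"
proof -
  have "(cyc c n, cyc c (n + 1), cyc c (n + 2)) \<in> triples 9 \<union> triples 10"
    using cyc_triples[OF assms(1), of n] assms(1) by auto
  from bspec[OF assms(2) this] show ?thesis
    by simp
qed

lemma qrad_bounds:
  assumes "c \<in> {9, 10}"
  shows "0 < qrad c n" "qrad c n \<le> qmid c n" "qmid c n + qrad c n \<le> 1"
  unfolding q_defs
  by (rule cyc_cases[OF assms, where Q = "\<lambda>x y z. 0 < snd (snd x)"], simp add: triples_def cycle_def)
    (rule cyc_cases[OF assms, where Q = "\<lambda>x y z. snd (snd x) \<le> fst (snd x)"], simp add: triples_def cycle_def,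
     rule cyc_cases[OF assms, where Q = "\<lambda>x y z. fst (snd x) + snd (snd x) \<le> 1"], simp add: triples_def cycle_def)

lemma qlab_pairs:
  assumes "c \<in> {9, 10}"
  shows "(qlab c n, qlab c (n + 1)) \<in> quad_pairs"
  unfolding q_defs
  by (rule cyc_cases[OF assms, where Q = "\<lambda>x y z. (fst x, fst y) \<in> quad_pairs"])
    (simp add: triples_def cycle_def quad_pairs_def)

lemma qlab_less: "c \<in> {9, 10} \<Longrightarrow> qlab c n < 4"
  using qlab_pairs[of c n] by (auto simp: quad_pairs_def)

lemma qlab_neq:
  assumes "c \<in> {9, 10}"
  shows "qlab c (n + 2) \<noteq> qlab c n"
  unfolding q_defs
  by (rule cyc_cases[OF assms, where Q = "\<lambda>x y z. fst z \<noteq> fst x"])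
    (simp add: triples_def cycle_def)

lemma quad_parallel:
  assumes "c \<in> {9, 10}"
  shows "cross (edge (quad A p q) (qlab c (n + 1)))
    (side_point (quad A p q) (qlab c (n + 2)) (qmid c (n + 2) - qrad c (n + 2) * u) -
     side_point (quad A p q) (qlab c n) (qmid c n + qrad c n * u)) = 0"
  unfolding q_defs
  by (rule cyc_cases[OF assms, where Q = "\<lambda>x y z. cross (edge (quad A p q) (fst y))
      (side_point (quad A p q) (fst z) (fst (snd z) - snd (snd z) * u) -
       side_point (quad A p q) (fst x) (fst (snd x) + snd (snd x) * u)) = 0"])
    (simp add: triples_def cycle_def cross_chord_quad field_simps)

lemma qlab_9_eq_1_iff: "qlab 9 n = 1 \<longleftrightarrow> n mod 9 = 2"
proof -
  have "0 \<le> n mod 9" "n mod 9 < 9"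
    by simp_all
  then have "n mod 9 = 0 \<or> n mod 9 = 1 \<or> n mod 9 = 2 \<or> n mod 9 = 3 \<or> n mod 9 = 4 \<or> n mod 9 = 5
    \<or> n mod 9 = 6 \<or> n mod 9 = 7 \<or> n mod 9 = 8"
    by presburger
  then show ?thesis
    by (auto simp: qlab_def cyc_def cycle_def)
qed

text \<open>The label 1 is always preceded by 3 in the cycle of length 9, but not in that of length 10.\<close>
lemma qlab_9_not_0_1: "\<not> (qlab 9 n = 0 \<and> qlab 9 (n + 1) = 1)"
proof
  assume *: "qlab 9 n = 0 \<and> qlab 9 (n + 1) = 1"
  then have "n mod 9 = 1"
    using qlab_9_eq_1_iff[of "n + 1"] by presburger
  with * show False
    by (auto simp: qlab_def cyc_def cycle_def)
qed

lemma qlab_10_0_1_iff: "qlab 10 n = 0 \<and> qlab 10 (n + 1) = 1 \<longleftrightarrow> n mod 10 = 2"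
proof -
  have "0 \<le> n mod 10" "n mod 10 < 10"
    by simp_all
  then have "n mod 10 = 0 \<or> n mod 10 = 1 \<or> n mod 10 = 2 \<or> n mod 10 = 3 \<or> n mod 10 = 4 \<or> n mod 10 = 5
    \<or> n mod 10 = 6 \<or> n mod 10 = 7 \<or> n mod 10 = 8 \<or> n mod 10 = 9"
    by presburger
  then show ?thesis
    by (auto simp: qlab_def cyc_def cycle_def mod_add_left_eq[symmetric, of n])
qed

lemma qlab_determines:
  assumes "c \<in> {9, 10}" "c' \<in> {9, 10}" and eq: "\<And>m. qlab c (n + m) = qlab c' (n' + m)"
  shows "c = c' \<and> int c dvd n' - n"
proof -
  have False if "c = 9" "c' = 10"
    using qlab_10_0_1_iff[of 2] qlab_9_not_0_1[of "n - n' + 2"]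
      eq[of "2 - n'"] eq[of "3 - n'"] that by (simp add: algebra_simps)
  moreover have False if "c = 10" "c' = 9"
    using qlab_10_0_1_iff[of 2] qlab_9_not_0_1[of "n' - n + 2"]
      eq[of "2 - n"] eq[of "3 - n"] that by (simp add: algebra_simps)
  moreover have "9 dvd n' - n" if "c = 9" "c' = 9"
    using qlab_9_eq_1_iff[of 2] qlab_9_eq_1_iff[of "n' - n + 2"] eq[of "2 - n"] that
    by (simp add: algebra_simps) presburger
  moreover have "10 dvd n' - n" if "c = 10" "c' = 10"
    using qlab_10_0_1_iff[of 2] qlab_10_0_1_iff[of "n' - n + 2"] eq[of "2 - n"] eq[of "3 - n"] that
    by (simp add: algebra_simps) presburger
  ultimately show ?thesis
    using assms(1,2) by auto
qed

locale quad_sequence =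
  fixes A p q :: point and L :: "int \<Rightarrow> nat" and a :: "int \<Rightarrow> real"
  assumes nondegenerate: "cross p q \<noteq> 0"
    and pairs: "(L m, L (m + 1)) \<in> quad_pairs"
    and pos: "0 < a m" and less_1: "a m < 1"
    and neq: "L (m + 2) \<noteq> L m"
    and parallel: "cross (edge (quad A p q) (L (m + 1)))
      (side_point (quad A p q) (L (m + 2)) (a (m + 2)) - side_point (quad A p q) (L m) (a m)) = 0"
begin

lemma pairs_cases: "L m = 0 \<and> L (m + 1) = 1 \<or> L m = 0 \<and> L (m + 1) = 2 \<or> L m = 1 \<and> L (m + 1) = 2
    \<or> L m = 2 \<and> L (m + 1) = 3 \<or> L m = 3 \<and> L (m + 1) = 0 \<or> L m = 3 \<and> L (m + 1) = 1"
  using pairs[of m] by (auto simp: quad_pairs_def)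

lemma pairs_cases': "L (m + 1) = 0 \<and> L (m + 2) = 1 \<or> L (m + 1) = 0 \<and> L (m + 2) = 2 \<or>
    L (m + 1) = 1 \<and> L (m + 2) = 2 \<or> L (m + 1) = 2 \<and> L (m + 2) = 3 \<or>
    L (m + 1) = 3 \<and> L (m + 2) = 0 \<or> L (m + 1) = 3 \<and> L (m + 2) = 1"
  using pairs_cases[of "m + 1"] by (simp add: add.assoc)

lemma step:
  "L m = 0 \<Longrightarrow> L (m + 1) = 1 \<Longrightarrow> L (m + 2) = 2 \<and> a (m + 2) = (1 - a m) / 3"
  "L m = 0 \<Longrightarrow> L (m + 1) = 2 \<Longrightarrow> L (m + 2) = 3 \<and> a (m + 2) = 1 - a m / 2"
  "L m = 1 \<Longrightarrow> L (m + 1) = 2 \<Longrightarrow> L (m + 2) = 3 \<and> a (m + 2) = (1 - a m) / 2"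
  "L m = 2 \<Longrightarrow> L (m + 1) = 3 \<Longrightarrow> L (m + 2) = 0 \<and> a (m + 2) = 3 / 2 * (1 - a m) \<or>
     L (m + 2) = 1 \<and> a (m + 2) = 1 - 3 * a m"
  "L m = 3 \<Longrightarrow> L (m + 1) = 0 \<Longrightarrow> L (m + 2) = 1 \<and> a (m + 2) = 4 - 4 * a m \<or>
     L (m + 2) = 2 \<and> a (m + 2) = 1 - 4 / 3 * a m"
  "L m = 3 \<Longrightarrow> L (m + 1) = 1 \<Longrightarrow> L (m + 2) = 2 \<and> a (m + 2) = 1 - 2 / 3 * a m"
  using pairs_cases'[of m] parallel[of m] nondegenerate
  by (auto simp: cross_chord_quad)

definition visits :: "real \<Rightarrow> real \<Rightarrow> bool" where
  "visits x y \<longleftrightarrow> (\<exists>m. L m = 2 \<and> L (m + 1) = 3 \<and> a m = x \<and> a (m + 1) = y)"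

lemma visits_bounds: "visits x y \<Longrightarrow> 0 < x \<and> x < 1 \<and> 0 < y \<and> y < 1"
  using pos less_1 by (auto simp: visits_def)

lemma first_return:
  assumes "visits x y"
  shows "x < 1 / 3 \<and> visits (1 - 2 / 3 * y) (3 / 2 * x)
    \<or> 1 / 3 < x \<and> 3 / 4 < y \<and> visits (x / 2 - 1 / 6) (2 * y - 3 / 2)
    \<or> 1 / 3 < x \<and> y < 3 / 4 \<and> visits (1 - 4 / 3 * y) (1 / 4 + 3 / 4 * x)"
proof -
  obtain m where m: "L m = 2" "L (m + 1) = 3" "a m = x" "a (m + 1) = y"
    using assms by (auto simp: visits_def)
  have sums: "m + 1 + 1 = m + 2" "m + 1 + 2 = m + 3" "m + 2 + 1 = m + 3" "m + 2 + 2 = m + 4"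
    "m + 3 + 1 = m + 4" "m + 3 + 2 = m + 5" "m + 4 + 1 = m + 5"
    by simp_all
  note step1 = step[of "m + 1", unfolded sums] and step2 = step[of "m + 2", unfolded sums]
    and step3 = step[of "m + 3", unfolded sums]
  note bounds = pos[of "m + 2"] less_1[of "m + 2"] pos[of "m + 3"] less_1[of "m + 3"]
  consider "L (m + 2) = 1" "a (m + 2) = 1 - 3 * x" | "L (m + 2) = 0" "a (m + 2) = 3 / 2 * (1 - x)"
    using step(4)[of m] m by auto
  then show ?thesis
  proof cases
    case 1
    then have "L (m + 3) = 2" "a (m + 3) = 1 - 2 / 3 * y"
      using step1(6) m by auto
    moreover from this 1 have "L (m + 4) = 3" "a (m + 4) = 3 / 2 * x"
      using step2(3) by auto
    ultimately have "visits (1 - 2 / 3 * y) (3 / 2 * x)"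
      unfolding visits_def by (intro exI[of _ "m + 3"]) (simp add: sums)
    moreover have "x < 1 / 3"
      using 1 bounds by simp
    ultimately show ?thesis
      by blast
  next
    case 2
    then have x: "1 / 3 < x"
      using bounds by simp
    consider "L (m + 3) = 1" "a (m + 3) = 4 - 4 * y" | "L (m + 3) = 2" "a (m + 3) = 1 - 4 / 3 * y"
      using step1(5) m 2 by auto
    then show ?thesis
    proof cases
      case 1
      then have "L (m + 4) = 2" "a (m + 4) = x / 2 - 1 / 6"
        using step2(1) 2 by (auto simp: field_simps)
      moreover from this 1 have "L (m + 5) = 3" "a (m + 5) = 2 * y - 3 / 2"
        using step3(3) by (auto simp: field_simps)
      ultimately have "visits (x / 2 - 1 / 6) (2 * y - 3 / 2)"
        unfolding visits_def by (intro exI[of _ "m + 4"]) (simp add: sums)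
      moreover have "3 / 4 < y"
        using 1 bounds by simp
      ultimately show ?thesis
        using x by blast
    next
      case b: 2
      then have "L (m + 4) = 3" "a (m + 4) = 1 / 4 + 3 / 4 * x"
        using step2(2) 2 by (auto simp: field_simps)
      then have "visits (1 - 4 / 3 * y) (1 / 4 + 3 / 4 * x)"
        using b unfolding visits_def by (intro exI[of _ "m + 3"]) (simp add: sums)
      moreover have "y < 3 / 4"
        using b bounds by simp
      ultimately show ?thesis
        using x by blast
    qed
  qed
qed

text \<open>The orbits excluded here are those that run into a vertex after at most two more returns.\<close>
lemma visits_regular:
  assumes "visits x y"
  shows "x \<noteq> 1 / 3" "1 / 3 < x \<Longrightarrow> y \<noteq> 3 / 4" "y < 1 / 2 \<Longrightarrow> x \<noteq> 2 / 3" "y \<noteq> 1 / 2"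
proof -
  have A: "x \<noteq> 1 / 3 \<and> (1 / 3 < x \<longrightarrow> y \<noteq> 3 / 4)" if "visits x y" for x y
    using first_return[OF that] by auto
  have B: "x \<noteq> 2 / 3" if "visits x y" "y < 1 / 2" for x y
    using first_return[OF that(1)] A[of "1 - 4 / 3 * y" "1 / 4 + 3 / 4 * x"] that(2) by auto
  show "x \<noteq> 1 / 3" "1 / 3 < x \<Longrightarrow> y \<noteq> 3 / 4" "y < 1 / 2 \<Longrightarrow> x \<noteq> 2 / 3"
    using A B assms by blast+
  show "y \<noteq> 1 / 2"
    using first_return[OF assms] A[of "1 - 4 / 3 * y" "1 / 4 + 3 / 4 * x"]
      B[of "1 - 2 / 3 * y" "3 / 2 * x"] by auto
qed

lemma visits_tile:
  assumes "visits x y"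
  shows "\<exists>c \<in> {9, 10}. \<exists>n. \<exists>(u, v) \<in> unit_square. qlab c n = 2 \<and> qlab c (n + 1) = 3 \<and>
    x = qmid c n + qrad c n * u \<and> y = qmid c (n + 1) + qrad c (n + 1) * v"
proof -
  have tile: ?thesis if c: "c \<in> {9, 10}" and lab: "qlab c n = 2" "qlab c (n + 1) = 3"
    and x: "\<bar>x - qmid c n\<bar> < qrad c n" and y: "\<bar>y - qmid c (n + 1)\<bar> < qrad c (n + 1)" for c n
  proof -
    have "((x - qmid c n) / qrad c n, (y - qmid c (n + 1)) / qrad c (n + 1)) \<in> unit_square"
      using x y qrad_bounds(1)[OF c] by (auto simp: unit_square_def field_simps abs_less_iff)
    moreover have "x = qmid c n + qrad c n * ((x - qmid c n) / qrad c n)"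
      "y = qmid c (n + 1) + qrad c (n + 1) * ((y - qmid c (n + 1)) / qrad c (n + 1))"
      using qrad_bounds(1)[OF c] by (simp_all add: less_imp_neq[symmetric])
    ultimately show ?thesis
      using c lab by blast
  qed
  note evals = q_defs cyc_def cycle_def
  have "0 < x \<and> x < 1 \<and> 0 < y \<and> y < 1"
    using visits_bounds[OF assms] .
  moreover have "x \<noteq> 1 / 3" "1 / 3 < x \<Longrightarrow> y \<noteq> 3 / 4" "y < 1 / 2 \<Longrightarrow> x \<noteq> 2 / 3" "y \<noteq> 1 / 2"
    using visits_regular[OF assms] by blast+
  moreover from this have "x < 1 / 3 \<or> 1 / 3 < x" "y < 1 / 2 \<or> 1 / 2 < y"
    "1 / 3 < x \<Longrightarrow> y < 3 / 4 \<or> 3 / 4 < y" "y < 1 / 2 \<Longrightarrow> x < 2 / 3 \<or> 2 / 3 < x"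
    by (auto simp: neq_iff)
  ultimately consider
      "0 < x" "x < 1 / 3" "1 / 2 < y" "y < 1"
    | "1 / 3 < x" "x < 2 / 3" "0 < y" "y < 1 / 2"
    | "1 / 3 < x" "x < 1" "1 / 2 < y" "y < 3 / 4"
    | "1 / 3 < x" "x < 1" "3 / 4 < y" "y < 1"
    | "0 < x" "x < 1 / 3" "0 < y" "y < 1 / 2"
    | "2 / 3 < x" "x < 1" "0 < y" "y < 1 / 2"
    by blast
  then show ?thesis
  proof cases
    case 1
    then show ?thesis
      by (intro tile[of 9 0]) (simp_all add: evals abs_if)
  next
    case 2
    then show ?thesis
      by (intro tile[of 9 3]) (simp_all add: evals abs_if)
  next
    case 3
    then show ?thesis
      by (intro tile[of 9 6]) (simp_all add: evals abs_if)
  next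
    case 4
    then show ?thesis
      by (intro tile[of 10 0]) (simp_all add: evals abs_if)
  next
    case 5
    then show ?thesis
      by (intro tile[of 10 4]) (simp_all add: evals abs_if)
  next
    case 6
    then show ?thesis
      by (intro tile[of 10 7]) (simp_all add: evals abs_if)
  qed
qed

lemma exhaust:
  "\<exists>m. b \<le> m \<and> m \<le> b + 3 \<and> (\<exists>c \<in> {9, 10}. \<exists>n. \<exists>(u, v) \<in> unit_square.
    L m = qlab c n \<and> L (m + 1) = qlab c (n + 1) \<and>
    a m = qmid c n + qrad c n * u \<and> a (m + 1) = qmid c (n + 1) + qrad c (n + 1) * v)"
proof -
  have 01: "L m = 1 \<Longrightarrow> L (m + 1) = 2" "L m = 0 \<Longrightarrow> L (m + 1) = 2 \<or> L (m + 2) = 2" for m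
    using pairs_cases[of m] pairs_cases'[of m] by auto
  have "L b = 2 \<or> L b = 0 \<or> L b = 1 \<or> L b = 3 \<and> (L (b + 1) = 0 \<or> L (b + 1) = 1)"
    using pairs_cases[of b] by auto
  then have "L b = 2 \<or> L (b + 1) = 2 \<or> L (b + 2) = 2 \<or> L (b + 3) = 2"
    using 01[of b] 01[of "b + 1"] by (auto simp: add.assoc)
  then obtain m where "m \<in> {b, b + 1, b + 2, b + 3}" "L m = 2"
    by blast
  then have m: "b \<le> m" "m \<le> b + 3" "L m = 2" "L (m + 1) = 3"
    using pairs_cases[of m] by auto
  then have "visits (a m) (a (m + 1))"
    by (auto simp: visits_def)
  then show ?thesis
    using visits_tile m by (intro exI[of _ m]) fastforce
qed

end

section \<open>Labellings of the vertices\<close>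

text \<open>The sign \<open>e\<close> is the orientation of \<open>quad A p q\<close>.  If it is negative, the polygon traverses
  the vertices in the opposite order, and its orbits are those of \<open>quad A p q\<close> run backwards.\<close>
locale quad_polygon = convex_polygon P for P +
  fixes \<sigma> :: "nat \<Rightarrow> nat" and e :: int and A p q :: point
  assumes orientation: "e = 1 \<or> e = - 1" "0 < real_of_int e * cross p q"
    and length_4: "length P = 4"
    and bij: "bij_betw \<sigma> {..<4} {..<4}"
    and edge_relabel: "i < 4 \<Longrightarrow> edge P (\<sigma> i) = real_of_int e *\<^sub>R edge (quad A p q) i"
    and side_point_relabel:
      "i < 4 \<Longrightarrow> side_point P (\<sigma> i) t = side_point (quad A p q) i (if e = 1 then t else 1 - t)"
begin

definition lab :: "nat \<Rightarrow> int \<Rightarrow> nat" where "lab c n = \<sigma> (qlab c (e * n))"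
definition mid :: "nat \<Rightarrow> int \<Rightarrow> real" where
  "mid c n = (if e = 1 then qmid c n else 1 - qmid c (- n))"
definition rad :: "nat \<Rightarrow> int \<Rightarrow> real" where "rad c n = qrad c (e * n)"

lemma relabel_less: "i < 4 \<Longrightarrow> \<sigma> i < 4"
  using bij by (auto simp: bij_betw_def)

lemma relabel_inject: "i < 4 \<Longrightarrow> j < 4 \<Longrightarrow> \<sigma> i = \<sigma> j \<longleftrightarrow> i = j"
  using bij by (auto simp: bij_betw_def inj_on_def)

lemma relabel_side_pairs:
  assumes "i < 4" "j < 4"
  shows "(\<sigma> i, \<sigma> j) \<in> side_pairs P \<longleftrightarrow> 0 < cross (edge (quad A p q) i) (edge (quad A p q) j)"
  using assms orientation(1) by (auto simp: side_pairs_def length_4 relabel_less edge_relabel cross_simps)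

lemma pair_iff:
  assumes "i < 4" "j < 4"
  shows "0 < cross (edge (quad A p q) i) (edge (quad A p q) j) \<longleftrightarrow>
    (if e = 1 then (i, j) \<in> quad_pairs else (j, i) \<in> quad_pairs)"
  using cross_edge_quad_pos_iff[OF assms orientation(2), of A]
    cross_edge_quad_pos_iff[OF assms(2,1) orientation(2), of A] orientation(1)
    cross_commute[of "edge (quad A p q) i"]
  by auto

lemma side_point_lab:
  assumes "c \<in> {9, 10}"
  shows "side_point P (lab c n) (mid c n + rad c n * u) =
    side_point (quad A p q) (qlab c (e * n)) (qmid c (e * n) + qrad c (e * n) * (real_of_int e * u))"
  using orientation(1) by (auto simp: lab_def mid_def rad_def side_point_relabel qlab_less[OF assms])

lemma side_cases:
  assumes "x \<in> side P k"
  obtains i t where "i < 4" "0 < t" "t < 1" "x = side_point (quad A p q) i t" "x \<in> side P (\<sigma> i)"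
    "k mod 4 = \<sigma> i"
proof -
  have "k mod 4 \<in> \<sigma> ` {..<4}"
    using bij by (simp add: bij_betw_def)
  then obtain i where i: "i < 4" "k mod 4 = \<sigma> i"
    by auto
  then have "x \<in> side P (\<sigma> i)"
    using assms side_mod[of P k] length_4 by metis
  then obtain t where "0 < t" "t < 1" "x = side_point P (\<sigma> i) t"
    by (auto simp: side_eq)
  then show ?thesis
    using that[of i "if e = 1 then t else 1 - t"] i \<open>x \<in> side P (\<sigma> i)\<close>
    by (simp add: side_point_relabel split: if_splits)
qed

lemma orbit_exhaust:
  assumes f: "full_orbit P f"
  shows "\<exists>m \<le> 0. \<exists>c \<in> {9, 10}. \<exists>n. \<exists>(u, v) \<in> unit_square.
        f m = (side_point P (lab c n) (mid c n + rad c n * u),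
               side_point P (lab c (n + 1)) (mid c (n + 1) + rad c (n + 1) * v))"
proof -
  define x where "x m = fst (f m)" for m
  have f_eq: "f m = (x m, x (m + 1))" for m
    using f by (simp add: full_orbit_def x_def symp_map_def split_beta prod_eq_iff)
  have "\<exists>i t. i < 4 \<and> 0 < t \<and> t < 1 \<and> x m = side_point (quad A p q) i t \<and> x m \<in> side P (\<sigma> i)" for m
  proof -
    have "f m \<in> phase_space P"
      using f by (simp add: full_orbit_def)
    then obtain k where "x m \<in> side P k"
      by (auto simp: phase_space_def f_eq)
    then obtain i t where "i < 4" "0 < t" "t < 1" "x m = side_point (quad A p q) i t" "x m \<in> side P (\<sigma> i)"
      by (rule side_cases)
    then show ?thesis
      by blast
  qed
  then obtain l t where l: "\<And>m. l m < 4" and t: "\<And>m. 0 < t m" "\<And>m. t m < 1"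
    and x: "\<And>m. x m = side_point (quad A p q) (l m) (t m)" and side: "\<And>m. x m \<in> side P (\<sigma> (l m))"
    by metis
  let ?E = "\<lambda>m. edge (quad A p q) (l m)"
  have l_eq: "k = \<sigma> (l m)" if "x m \<in> side P k" "k < 4" for k m
    using side_unique[OF that(1) side] that(2) relabel_less[OF l] by (simp add: length_4)
  have pos: "0 < cross (?E m) (?E (m + 1))" for m
  proof -
    have "f m \<in> phase_space P"
      using f by (simp add: full_orbit_def)
    then obtain i j where "(i, j) \<in> side_pairs P" "x m \<in> side P i" "x (m + 1) \<in> side P j"
      by (auto simp: phase_space_def f_eq)
    then have "(\<sigma> (l m), \<sigma> (l (m + 1))) \<in> side_pairs P"
      using l_eq by (auto simp: side_pairs_def length_4)
    then show ?thesis
      using relabel_side_pairs l by blast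
  qed
  have step: "x (m + 2) \<noteq> x m \<and> cross (?E (m + 1)) (x (m + 2) - x m) = 0" for m
  proof -
    have "symp_map P (x m, x (m + 1)) = (x (m + 1), x (m + 2))"
      using f f_eq[of m] f_eq[of "m + 1"] by (simp add: full_orbit_def add.assoc)
    moreover have "cross (edge P (\<sigma> (l m))) (edge P (\<sigma> (l (m + 1)))) \<noteq> 0"
      using pos[of m] orientation(1) l by (auto simp: edge_relabel cross_simps)
    ultimately show ?thesis
      using symp_map_iff[OF side side side] orientation(1) l by (auto simp: edge_relabel cross_simps)
  qed
  have neq: "l (m + 2) \<noteq> l m" for m
  proof
    assume eq: "l (m + 2) = l m"
    have "x (m + 2) - x m = (t (m + 2) - t m) *\<^sub>R ?E m"
      unfolding x eq side_point_def by (simp add: algebra_simps)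
    then have "(t (m + 2) - t m) * cross (?E (m + 1)) (?E m) = 0"
      using step[of m] by (simp add: cross_simps)
    moreover have "cross (?E (m + 1)) (?E m) \<noteq> 0"
      using pos[of m] cross_commute[of "?E m"] by simp
    ultimately have "x (m + 2) = x m"
      by (simp add: x eq)
    then show False
      using step[of m] by blast
  qed
  interpret quad_sequence A p q "\<lambda>m. l (e * m)" "\<lambda>m. t (e * m)"
  proof
    show "cross p q \<noteq> 0"
      using orientation by auto
    fix m
    show "0 < t (e * m)" "t (e * m) < 1"
      using t by auto
    show "(l (e * m), l (e * (m + 1))) \<in> quad_pairs"
      using orientation(1) pos[of m] pos[of "- m - 1"] pair_iff[OF l l, of m "m + 1"]
        pair_iff[OF l l, of "- m - 1" "- m"] by auto
    show "l (e * (m + 2)) \<noteq> l (e * m)"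
      using orientation(1) neq[of m] neq[of "- m - 2"] by auto
    have "cross (?E (e * (m + 1))) (x (e * (m + 2)) - x (e * m)) = 0"
      using orientation(1) step[of m] step[of "- m - 2"] by (auto simp: cross_simps add.commute)
    then show "cross (edge (quad A p q) (l (e * (m + 1))))
      (side_point (quad A p q) (l (e * (m + 2))) (t (e * (m + 2))) -
       side_point (quad A p q) (l (e * m)) (t (e * m))) = 0"
      by (simp add: x)
  qed
  obtain m c n u v where m: "(if e = 1 then - 3 else 0) \<le> m" "m \<le> (if e = 1 then - 3 else 0) + 3"
    and c: "c \<in> {9, 10}" and uv: "(u, v) \<in> unit_square"
    and eq: "l (e * m) = qlab c n" "l (e * (m + 1)) = qlab c (n + 1)"
      "t (e * m) = qmid c n + qrad c n * u"
      "t (e * (m + 1)) = qmid c (n + 1) + qrad c (n + 1) * v"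
    using exhaust[of "if e = 1 then - 3 else 0"]
    by (simp only: Bex_def split_paired_Ex prod.case) blast
  have x_eq: "x (e * m) = side_point (quad A p q) (qlab c n) (qmid c n + qrad c n * u)"
    "x (e * (m + 1)) = side_point (quad A p q) (qlab c (n + 1)) (qmid c (n + 1) + qrad c (n + 1) * v)"
    by (simp_all add: x eq)
  show ?thesis
  proof (cases "e = 1")
    case True
    then have "f m = (side_point P (lab c n) (mid c n + rad c n * u),
               side_point P (lab c (n + 1)) (mid c (n + 1) + rad c (n + 1) * v))"
      unfolding side_point_lab[OF c] using x_eq by (simp add: f_eq)
    then show ?thesis
      using c uv m True by fastforce
  next
    case False
    then have e: "e = - 1"
      using orientation(1) by blast
    let ?n = "- n - 1"
    have "f (- m - 1) = (side_point P (lab c ?n) (mid c ?n + rad c ?n * (- v)),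
               side_point P (lab c (?n + 1)) (mid c (?n + 1) + rad c (?n + 1) * (- u)))"
      unfolding side_point_lab[OF c] using x_eq by (simp add: f_eq e add.commute[of 1 n])
    moreover have "(- v, - u) \<in> unit_square"
      using uv by (auto simp: unit_square_def)
    moreover have "- m - 1 \<le> 0"
      using m e by simp
    ultimately show ?thesis
      using c by blast
  qed
qed

lemma q_period:
  "qlab c (n + int c) = qlab c n" "qmid c (n + int c) = qmid c n" "qrad c (n + int c) = qrad c n"
  "qlab c (n - int c) = qlab c n" "qmid c (n - int c) = qmid c n" "qrad c (n - int c) = qrad c n"
  by (simp_all add: q_defs cyc_period)

sublocale rotating_tiles P lab mid rad
proof
  fix c :: nat assume c: "c \<in> {9, 10}"
  note e = orientation(1)
  show "lab c (n + int c) = lab c n" "mid c (n + int c) = mid c n" "rad c (n + int c) = rad c n" for n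
    using e q_period[of c n] q_period[of c "- n"] by (auto simp: lab_def mid_def rad_def)
  show "0 < rad c n" "rad c n \<le> mid c n" "mid c n + rad c n \<le> 1" for n
    using e qrad_bounds[OF c, of n] qrad_bounds[OF c, of "- n"] by (auto simp: mid_def rad_def)
  show "(lab c n, lab c (n + 1)) \<in> side_pairs P" for n
    using e qlab_pairs[OF c, of n] qlab_pairs[OF c, of "- n - 1"]
    by (auto simp: lab_def relabel_side_pairs pair_iff qlab_less[OF c])
  show "lab c (n + 2) \<noteq> lab c n" for n
    using e qlab_neq[OF c, of n] qlab_neq[OF c, of "- n - 2"]
    by (auto simp: lab_def relabel_inject qlab_less[OF c])
  show "cross (edge P (lab c (n + 1)))
        (side_point P (lab c (n + 2)) (mid c (n + 2) - rad c (n + 2) * u) -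
         side_point P (lab c n) (mid c n + rad c n * u)) = 0" for n u
  proof -
    have "side_point P (lab c (n + 2)) (mid c (n + 2) - rad c (n + 2) * u) =
      side_point P (lab c (n + 2)) (mid c (n + 2) + rad c (n + 2) * (- u))"
      by simp
    moreover have shift: "- (n + 2) + 1 = - (n + 1)" "- (n + 2) + 2 = - n"
      by simp_all
    ultimately show ?thesis
      unfolding side_point_lab[OF c]
      using e quad_parallel[OF c, of A p q n u] quad_parallel[OF c, of A p q "- (n + 2)" u, unfolded shift]
      by (auto simp: lab_def edge_relabel qlab_less[OF c] cross_simps)
  qed
  show "c = c' \<and> int c dvd n' - n"
    if c': "c' \<in> {9, 10}" and eq: "\<And>m. lab c (n + m) = lab c' (n' + m)" for c' n n'
  proof -
    have "qlab c (e * n + m) = qlab c' (e * n' + m)" for m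
      using eq[of "e * m"] e
      by (auto simp: lab_def relabel_inject qlab_less[OF c] qlab_less[OF c'] algebra_simps)
    then have "c = c' \<and> int c dvd e * n' - e * n"
      using qlab_determines[OF c c'] by blast
    then show ?thesis
      using e by (auto simp: dvd_diff_commute)
  qed
next
  fix f assume "full_orbit P f"
  then show "\<exists>m \<le> 0. \<exists>c \<in> {9, 10}. \<exists>n. \<exists>(u, v) \<in> unit_square.
        f m = (side_point P (lab c n) (mid c n + rad c n * u),
               side_point P (lab c (n + 1)) (mid c (n + 1) + rad c (n + 1) * v))"
    by (rule orbit_exhaust)
qed

end

lemma (in convex_polygon) distinct_vertices: "distinct P"
proof (rule distinct_conv_nth[THEN iffD2], intro allI impI)
  fix i j assume ij: "i < length P" "j < length P" "i \<noteq> j"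
  then have ne: "i mod length P \<noteq> j mod length P"
    by simp
  have "vertex P i \<noteq> vertex P j"
  proof (cases "j mod length P = Suc i mod length P")
    case True
    then have "vertex P j = vertex P (Suc i)"
      by (metis vertex_mod)
    then show ?thesis
      using edge_nonzero[of i] by (auto simp: edge_def)
  next
    case False
    then show ?thesis
      using left_of_edge[of j i] ne by (auto simp: cross_simps)
  qed
  then show "P ! i \<noteq> P ! j"
    using ij by (simp add: vertex_def)
qed

lemma affinely_equivalent_quad:
  assumes "affinely_equivalent {(0, 0), (2, 0), (3, 1), (0, 4)} S"
  obtains A p q where "S = set (quad A p q)" "card S = 4"
proof -
  obtain h c where h: "linear h" "bij h" and S: "S = (\<lambda>x. c + h x) ` {(0, 0), (2, 0), (3, 1), (0, 4) :: point}"
    using assms unfolding affinely_equivalent_def by blast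
  have "(3, 1) = (3 / 2) *\<^sub>R (2, 0) + (1 / 4) *\<^sub>R ((0, 4) :: point)"
    by simp
  then have "h (3, 1) = (3 / 2) *\<^sub>R h (2, 0) + (1 / 4) *\<^sub>R h (0, 4)"
    by (simp only: linear_add[OF h(1)] linear_scale[OF h(1)])
  moreover have "h (0, 0) = 0"
    using linear_0[OF h(1)] by (simp add: zero_prod_def)
  ultimately have "S = set (quad c (h (2, 0)) (h (0, 4)))"
    by (simp add: S quad_def add.assoc)
  moreover have "inj (\<lambda>x. c + h x)"
    using h(2) by (auto simp: inj_def bij_def)
  then have "card S = 4"
    unfolding S by (simp add: card_image[OF inj_on_subset] del: image_insert)
  ultimately show ?thesis
    using that by blast
qed

lemma vertex_quad:
  "vertex (quad A p q) 0 = A"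
  "vertex (quad A p q) (Suc 0) = A + p"
  "vertex (quad A p q) 2 = A + (3 / 2) *\<^sub>R p + (1 / 4) *\<^sub>R q"
  "vertex (quad A p q) 3 = A + q"
  "vertex (quad A p q) 4 = A"
  by (simp_all add: vertex_def quad_def)

lemma le_4_cases: "(i :: nat) \<le> 4 \<longleftrightarrow> i = 0 \<or> i = 1 \<or> i = 2 \<or> i = 3 \<or> i = 4"
  by auto

lemma bij_betw_mod_4:
  fixes f :: "nat \<Rightarrow> nat"
  assumes "\<And>i j. i < 4 \<Longrightarrow> j < 4 \<Longrightarrow> f i mod 4 = f j mod 4 \<Longrightarrow> i = j"
  shows "bij_betw (\<lambda>i. f i mod 4) {..<4} {..<4}"
proof -
  have "inj_on (\<lambda>i. f i mod 4) {..<4}"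
    by (rule inj_onI, rule assms) (simp_all only: lessThan_iff)
  moreover from this have "(\<lambda>i. f i mod 4) ` {..<4} = {..<4}"
    by (intro endo_inj_surj) auto
  ultimately show ?thesis
    by (simp add: bij_betw_def)
qed

lemma (in convex_polygon) quad_polygon_exists:
  assumes P: "set P = set (quad A p q)" "length P = 4"
  shows "\<exists>\<sigma> e. quad_polygon P \<sigma> e A p q"
proof -
  have "A \<in> set P"
    by (simp add: P quad_def)
  then obtain r where "r < 4" "A = P ! r"
    using P(2) by (metis in_set_conv_nth)
  then have W0: "vertex P r = A" "vertex P (r + 4) = A"
    using P(2) by (simp_all add: vertex_def)
  define B C D where "B = A + p" and "C = A + (3 / 2) *\<^sub>R p + (1 / 4) *\<^sub>R q" and "D = A + q"
  note BCD = B_def C_def D_def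
  let ?W = "\<lambda>k. vertex P (r + k)"
  have mod4: "(r + i) mod 4 = (r + j) mod 4 \<longleftrightarrow> i mod 4 = j mod 4" for r i j :: nat
    unfolding of_nat_eq_iff[where 'a = int, symmetric]
    by (simp only: of_nat_mod mod_eq_dvd_iff of_nat_add add_diff_cancel_left)
  have inj: "?W i \<noteq> ?W j" if "i < 4" "j < 4" "i \<noteq> j" for i j
    using that mod4[of r i j] distinct_vertices P(2) by (simp add: vertex_def nth_eq_iff_index_eq)
  have "?W i \<in> {A, B, C, D}" for i
    using vertex_in_set[of "r + i"] by (simp add: P quad_def BCD)
  then have W: "?W i \<in> {B, C, D}" if "0 < i" "i < 4" for i
    using inj[of i 0] that W0 by auto
  have left: "0 < cross (?W i' - ?W i) (?W k - ?W i)"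
    if "i < 4" "k < 4" "k \<noteq> i" "i' = Suc i" "k mod 4 \<noteq> i' mod 4" for i i' k
  proof -
    have "(r + k) mod 4 \<noteq> (r + i) mod 4" "(r + k) mod 4 \<noteq> Suc (r + i) mod 4"
      using that mod4[of r k i] mod4[of r k "Suc i"] by auto
    then show ?thesis
      using left_of_edge[of "r + k" "r + i"] P(2) that(4) by (simp add: edge_def)
  qed
  have cross_qp: "cross q p = - cross p q"
    by (rule cross_commute)
  have "?W 1 = B \<and> ?W 2 = C \<and> ?W 3 = D \<and> 0 < cross p q \<or> ?W 1 = D \<and> ?W 2 = C \<and> ?W 3 = B \<and> cross p q < 0"
  proof -
    have "?W 1 \<in> {B, C, D}" "?W 2 \<in> {B, C, D}" "?W 3 \<in> {B, C, D}"
      using W[of 1] W[of 2] W[of 3] by simp_all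
    moreover have "?W 1 \<noteq> ?W 2" "?W 1 \<noteq> ?W 3" "?W 2 \<noteq> ?W 3"
      using inj[of 1 2] inj[of 1 3] inj[of 2 3] by simp_all
    ultimately have perm: "?W 1 = B \<and> ?W 2 = C \<and> ?W 3 = D \<or> ?W 1 = B \<and> ?W 2 = D \<and> ?W 3 = C \<or>
      ?W 1 = C \<and> ?W 2 = B \<and> ?W 3 = D \<or> ?W 1 = C \<and> ?W 2 = D \<and> ?W 3 = B \<or>
      ?W 1 = D \<and> ?W 2 = B \<and> ?W 3 = C \<or> ?W 1 = D \<and> ?W 2 = C \<and> ?W 3 = B"
      unfolding insert_iff empty_iff by metis
    have "0 < cross (?W 1 - A) (?W 2 - A)" "0 < cross (?W 1 - A) (?W 3 - A)"
      "0 < cross (?W 3 - ?W 2) (A - ?W 2)" "0 < cross (?W 2 - ?W 1) (A - ?W 1)"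
      using left[of 0 2 1] left[of 0 3 1] left[of 2 0 3] left[of 1 0 2] W0(1) by simp_all
    moreover have "B - A = p" "D - A = q" "C - A = (3 / 2) *\<^sub>R p + (1 / 4) *\<^sub>R q"
      "A - B = - p" "C - B = (1 / 2) *\<^sub>R p + (1 / 4) *\<^sub>R q" "D - B = q - p"
      "A - C = - ((3 / 2) *\<^sub>R p + (1 / 4) *\<^sub>R q)" "B - C = - ((1 / 2) *\<^sub>R p + (1 / 4) *\<^sub>R q)"
      "D - C = (3 / 4) *\<^sub>R q - (3 / 2) *\<^sub>R p"
      "A - D = - q" "B - D = p - q" "C - D = (3 / 2) *\<^sub>R p - (3 / 4) *\<^sub>R q"
      by (simp_all add: BCD prod_eq_iff)
    ultimately show ?thesis
      using perm by (elim disjE conjE; simp only: cross_simps cross_qp; simp)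
  qed
  then show ?thesis
  proof (elim disjE conjE)
    assume W: "?W 1 = B" "?W 2 = C" "?W 3 = D" and pos: "0 < cross p q"
    have vertex: "vertex P (r + i) = vertex (quad A p q) i" if "i \<le> 4" for i
      using that unfolding le_4_cases by (elim disjE) (simp_all add: W[simplified] W0 BCD vertex_quad)
    have edge: "edge P (r + i) = edge (quad A p q) i" if "i < 4" for i
      using that vertex[of i] vertex[of "Suc i"] by (simp add: edge_def)
    then have side_point: "side_point P (r + i) t = side_point (quad A p q) i t" if "i < 4" for i t
      using that vertex[of i] by (simp add: side_point_def)
    have "bij_betw (\<lambda>i. (r + i) mod 4) {..<4} {..<4}"
      using mod4[of r] by (intro bij_betw_mod_4) simp
    then have "quad_polygon P (\<lambda>i. (r + i) mod 4) 1 A p q"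
      using pos P(2) edge side_point edge_mod[of P] side_point_mod[of P]
      by unfold_locales (simp_all)
    then show ?thesis
      by blast
  next
    assume W: "?W 1 = D" "?W 2 = C" "?W 3 = B" and neg: "cross p q < 0"
    have vertex: "vertex P (r + 4 - i) = vertex (quad A p q) i" if "i \<le> 4" for i
      using that unfolding le_4_cases by (elim disjE) (simp_all add: W[simplified] W(3)[unfolded add.commute[of r]] W0 BCD vertex_quad)
    have shift: "r + 3 - i = r + 4 - Suc i" "Suc (r + 3 - i) = r + 4 - i" if "i < 4" for i
      using that by simp_all
    have edge: "edge P (r + 3 - i) = - edge (quad A p q) i" if "i < 4" for i
      unfolding edge_def shift(2)[OF that] using that vertex[of i] vertex[of "Suc i"]
      unfolding shift(1)[OF that] by simp
    have side_point: "side_point P (r + 3 - i) t = side_point (quad A p q) i (1 - t)" if "i < 4" for i t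
      unfolding side_point_def edge[OF that] unfolding shift(1)[OF that] using that vertex[of "Suc i"]
      by (simp add: edge_def algebra_simps)
    have "bij_betw (\<lambda>i. (r + 3 - i) mod 4) {..<4} {..<4}"
    proof -
      have "i = j" if "i < 4" "j < 4" "(r + 3 - i) mod 4 = (r + 3 - j) mod 4" for i j
        using that mod4[of r "3 - i" "3 - j"] by simp
      then show ?thesis
        by (rule bij_betw_mod_4)
    qed
    then have "quad_polygon P (\<lambda>i. (r + 3 - i) mod 4) (- 1) A p q"
      using neg P(2) edge side_point edge_mod[of P] side_point_mod[of P]
      by unfold_locales (simp_all)
    then show ?thesis
      by blast
  qed
qed

theorem theorem3p1:
  fixes Q :: "(real \<times> real) list"
  assumes "ccw_convex_polygon Q"
    and "affinely_equivalent {(0, 0), (2, 0), (3, 1), (0, 4)} (set Q)"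
  shows "(\<forall>p \<in> regular_points Q. has_period Q 20 p \<or> has_period Q 36 p) \<and>
    (\<exists>p \<in> regular_points Q. has_period Q 20 p) \<and>
    (\<exists>p \<in> regular_points Q. has_period Q 36 p) \<and>
    (\<exists>O1 O2. tile_orbit Q ` periodic_tiles Q = {O1, O2} \<and> O1 \<noteq> O2 \<and>
      (\<forall>M \<in> O1. M \<in> periodic_tiles Q \<and> returns_after Q M 10 \<and>
         has_order_on (symp_map Q ^^ 10) M 2) \<and>
      (\<forall>M \<in> O2. M \<in> periodic_tiles Q \<and> returns_after Q M 9 \<and>
         has_order_on (symp_map Q ^^ 9) M 4))"
proof -
  interpret convex_polygon Q
    using assms(1) by unfold_locales
  obtain A p q where "set Q = set (quad A p q)" "card (set Q) = 4"
    using affinely_equivalent_quad[OF assms(2)] .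
  moreover from this have "length Q = 4"
    using distinct_card[OF distinct_vertices] by simp
  ultimately obtain \<sigma> e where "quad_polygon Q \<sigma> e A p q"
    using quad_polygon_exists by blast
  then interpret quad_polygon Q \<sigma> e A p q .
  show ?thesis
    by (rule periods_and_tiles)
qed

end
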